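(* Let $C>0$ and $\varepsilon>0$. For all sufficiently large $n$ (depending on $C$ and $\varepsilon$), if $P \subset [0,1]^2$ is a set of $n$ points such that every axis-parallel $n^{-1/2}\times n^{-1/2}$ square contains at most $C$ points of $P$, then $P$ contains three points forming a triangle of area at most $n^{-7/6+\varepsilon}$.
   Context: A set $P$ of $n$ points in $[0,1]^2$ is called homogeneous if there is an absolute constant $C>0$ such that every axis-parallel $n^{-1/2}\times n^{-1/2}$ square contains at most $C$ points of $P$; the claim is the statement that homogeneous sets contain triangles of area at most $n^{-7/6+\varepsilon}$ for every $\varepsilon>0$ and large $n$. *)

theory Defs
  imports "HOL-Analysis.Analysis"
begin

text \<open>
  In \<open>real^2\<close>, \<open>1\<close> is the all-ones vector, so \<open>cbox a (a + s *\<^sub>R 1)\<close> is the closed axis-parallel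
  square of side \<open>s\<close> with lower left corner \<open>a\<close>, and \<open>cbox 0 1\<close> is the unit square.
\<close>

definition axis_square :: "real^2 \<Rightarrow> real \<Rightarrow> (real^2) set" where
  "axis_square a s = cbox a (a + s *\<^sub>R 1)"

definition homogeneous :: "real \<Rightarrow> (real^2) set \<Rightarrow> bool" where
  "homogeneous C P \<longleftrightarrow>
     (\<forall>a. real (card (P \<inter> axis_square a (real (card P) powr (-1/2)))) \<le> C)"

end

theory Submission
  imports Defs "HOL-Real_Asymp.Real_Asymp"
begin

text \<open>
  The proof is the high-low method. For a family of lines \<open>y = a x + b\<close> let \<open>\<beta> w\<close> be the number of pairs of
  a point and a line at distance at most about \<open>w\<close>, divided by \<open>w\<close>. By Cauchy-Schwarz and the almost
  orthogonality of transversal lines, \<open>(w * \<beta>' w)\<^sup>2\<close> is at most about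
  \<open>\<bar>P\<bar> * \<bar>L\<bar> * M\<^sub>P * M\<^sub>L / w ^ 3\<close>, where \<open>M\<^sub>P\<close> and \<open>M\<^sub>L\<close> bound the number of points in a square
  of side \<open>w\<close> and the number of lines in a square of side \<open>w\<close> of the \<open>(a, b)\<close>-plane.

  Cut the unit square into cells of side \<open>n powr (-1/2 + \<epsilon>/2)\<close>. By the pigeonhole principle a well populated cell
  contains, for every slope of a net of about \<open>D\<close> slopes (\<open>D\<close> a small power of \<open>n\<close>), two points at distance at
  least \<open>n powr (-1/2)\<close> that span a line of about this slope. Take these lines. Since all slopes occur, \<open>\<beta>\<close> has
  the expected size \<open>\<bar>P\<bar> * \<bar>L\<bar>\<close> at \<open>w = 10 / D\<close>. If there is no small triangle, then every line stays at distance
  \<open>w\<^sub>1\<close>, which is about \<open>n powr (-2/3)\<close>, from all points but the two that span it. Hence \<open>\<beta> w\<^sub>1\<close> is tiny, and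
  any two of the lines are \<open>w\<^sub>1\<close>-separated, which together with homogeneity bounds \<open>M\<^sub>L\<close> well enough for
  \<open>\<beta>\<close> to be nearly constant between \<open>w\<^sub>1\<close> and \<open>10 / D\<close>: a contradiction.
\<close>

section \<open>A compactly supported bump function\<close>

definition bump :: "real \<Rightarrow> real" where "bump t = max 0 (1 - t\<^sup>2)"

lemma bump_nonneg: "0 \<le> bump t" and bump_le_1: "bump t \<le> 1"
  by (auto simp: bump_def)

lemma bump_eq_0: "1 \<le> \<bar>t\<bar> \<Longrightarrow> bump t = 0"
  by (simp add: bump_def one_le_power abs_le_square_iff[of 1 t, simplified])

text \<open>Off \<open>u = 0\<close> this is the chain rule. At \<open>u = 0\<close> the exponent
  \<open>k + 2\<close> is at least 2, so the difference quotient of \<open>max 0 u ^ (k+2)\<close>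
  is bounded by \<open>\<bar>h\<bar> ^ (k+1)\<close> and tends to 0.\<close>

lemma has_field_derivative_bump_power:
  assumes "(f has_field_derivative f') (at t)"
  shows "((\<lambda>t. bump (f t) ^ (k+2)) has_field_derivative - (2 * (real k + 2) * f t * bump (f t) ^ (k+1) * f')) (at t)"
proof -
  have *: "((\<lambda>u. max 0 u ^ (k+2)) has_field_derivative ((real k + 2) * max 0 u ^ (k+1))) (at u)" for u :: real
  proof -
    consider "u > 0" | "u < 0" | "u = 0" by linarith
    then show ?thesis
    proof cases
      case 1
      have "((\<lambda>u. u ^ (k+2)) has_field_derivative ((real k + 2) * max 0 u ^ (k+1))) (at u)"
        using 1 DERIV_pow[of "k+2" u] by (simp add: add.commute)
      then show ?thesis
        by (rule has_field_derivative_transform_within_open[where S = "{0<..}"]) (use 1 in auto)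
    next
      case 2
      have "((\<lambda>u. 0) has_field_derivative ((real k + 2) * max 0 u ^ (k+1))) (at u)"
        using 2 by (auto intro!: derivative_eq_intros)
      then show ?thesis
        by (rule has_field_derivative_transform_within_open[where S = "{..<0}"]) (use 2 in auto)
    next
      case 3
      have "((\<lambda>h::real. max 0 h ^ (k+2) / h) \<longlongrightarrow> 0) (at 0)"
      proof (rule tendsto_rabs_zero_cancel, rule tendsto_sandwich[where f = "\<lambda>_. 0" and h = "\<lambda>h. \<bar>h\<bar> ^ (k+1)"])
        show "\<forall>\<^sub>F h in at (0::real). \<bar>max 0 h ^ (k+2) / h\<bar> \<le> \<bar>h\<bar> ^ (k+1)"
          by (rule always_eventually) (auto simp: max_def intro!: mult_nonpos_nonneg)
        have "((\<lambda>h::real. \<bar>h\<bar> ^ (k+1)) \<longlongrightarrow> \<bar>0\<bar> ^ (k+1)) (at 0)"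
          by (intro tendsto_intros)
        then show "((\<lambda>h::real. \<bar>h\<bar> ^ (k+1)) \<longlongrightarrow> 0) (at 0)" by simp
        show "\<forall>\<^sub>F h in at (0::real). 0 \<le> \<bar>max 0 h ^ (k+2) / h\<bar>" by simp
      qed auto
      then show ?thesis using 3 by (simp add: DERIV_def)
    qed
  qed
  have "((\<lambda>t. 1 - (f t)\<^sup>2) has_field_derivative - (2 * f t * f')) (at t)"
    by (auto intro!: derivative_eq_intros assms)
  from DERIV_chain2[OF * this] show ?thesis
    by (simp add: bump_def algebra_simps)
qed

text \<open>For \<open>k \<le> 4\<close>, \<open>bump_deriv k\<close> is the \<open>k\<close>-th derivative of \<open>- (bump ^ 5) / 10\<close>; larger \<open>k\<close> are junk.\<close>

fun bump_deriv :: "nat \<Rightarrow> real \<Rightarrow> real" where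
  "bump_deriv 0 t = - (bump t ^ 5) / 10"
| "bump_deriv (Suc 0) t = t * bump t ^ 4"
| "bump_deriv (Suc (Suc 0)) t = bump t ^ 4 - 8 * t\<^sup>2 * bump t ^ 3"
| "bump_deriv (Suc (Suc (Suc 0))) t = - 24 * t * bump t ^ 3 + 48 * t ^ 3 * bump t ^ 2"
| "bump_deriv (Suc (Suc (Suc (Suc _)))) t = - 24 * bump t ^ 3 + 288 * t\<^sup>2 * bump t ^ 2 - 192 * t ^ 4 * bump t"

text \<open>The fifth power leaves room for four continuous derivatives. Order 2 arises when the
  incidence count is differentiated in the scale, orders 3 and 4 when that is bounded pointwise, and
  orders 0 and 1 serve as its antiderivatives.\<close>

lemma has_field_derivative_bump_deriv:
  assumes "k < 4"
  shows "(bump_deriv k has_field_derivative bump_deriv (Suc k) t) (at t)"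
proof -
  note d = has_field_derivative_bump_power[OF DERIV_ident]
  have d5: "((\<lambda>t. bump t ^ 5) has_field_derivative - (10 * t * bump t ^ 4)) (at t)"
    using d[of 3] by (simp add: numeral_eq_Suc)
  have d4: "((\<lambda>t. bump t ^ 4) has_field_derivative - (8 * t * bump t ^ 3)) (at t)"
    using d[of 2] by (simp add: numeral_eq_Suc)
  have d3: "((\<lambda>t. bump t ^ 3) has_field_derivative - (6 * t * bump t ^ 2)) (at t)"
    using d[of 1] by (simp add: numeral_eq_Suc)
  have d2: "((\<lambda>t. bump t ^ 2) has_field_derivative - (4 * t * bump t)) (at t)"
    using d[of 0] by (simp add: numeral_eq_Suc)
  have "k = 0 \<or> k = 1 \<or> k = 2 \<or> k = 3" using assms by linarith
  then consider "k = 0" | "k = 1" | "k = 2" | "k = 3" by blast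
  then show ?thesis
  proof cases
    case 1
    have "bump_deriv 0 = (\<lambda>t. - (bump t ^ 5) / 10)" by auto
    then show ?thesis using 1 DERIV_cdivide[OF DERIV_minus[OF d5], of 10] by simp
  next
    case 2
    have "bump_deriv 1 = (\<lambda>t. t * bump t ^ 4)" by auto
    then show ?thesis using 2 DERIV_mult[OF DERIV_ident d4]
      by (simp add: algebra_simps power2_eq_square)
  next
    case 3
    have eq: "bump_deriv 2 = (\<lambda>t. bump t ^ 4 - 8 * t\<^sup>2 * bump t ^ 3)"
      "bump_deriv (Suc 2) t = - 24 * t * bump t ^ 3 + 48 * t ^ 3 * bump t ^ 2" by (auto simp: numeral_2_eq_2)
    have e: "((\<lambda>t. 8 * t\<^sup>2) has_field_derivative 16 * t) (at t)"
      by (auto intro!: derivative_eq_intros)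
    show ?thesis unfolding 3 eq
      by (rule DERIV_cong[OF DERIV_diff[OF d4 DERIV_mult[OF e d3]]]) algebra
  next
    case 4
    have eq: "bump_deriv 3 = (\<lambda>t. - 24 * t * bump t ^ 3 + 48 * t ^ 3 * bump t ^ 2)"
      "bump_deriv (Suc 3) t = - 24 * bump t ^ 3 + 288 * t\<^sup>2 * bump t ^ 2 - 192 * t ^ 4 * bump t"
      by (auto simp: numeral_3_eq_3)
    have e: "((\<lambda>t. - 24 * t) has_field_derivative - 24) (at t)"
      "((\<lambda>t. 48 * t ^ 3) has_field_derivative 144 * t\<^sup>2) (at t)"
      by (auto intro!: derivative_eq_intros)
    show ?thesis unfolding 4 eq
      by (rule DERIV_cong[OF DERIV_add[OF DERIV_mult[OF e(1) d3] DERIV_mult[OF e(2) d2]]]) algebra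
  qed
qed

lemma continuous_on_bump: "continuous_on S bump"
  unfolding bump_def by (intro continuous_intros)

lemma continuous_on_bump_deriv: "continuous_on S (bump_deriv k)"
proof -
  note [continuous_intros] = continuous_on_compose2[OF continuous_on_bump[of UNIV], simplified]
  consider "k = 0" | "k = 1" | "k = 2" | "k = 3" | j where "k = Suc (Suc (Suc (Suc j)))"
    by (metis One_nat_def Suc_1 numeral_3_eq_3 old.nat.exhaust)
  then show ?thesis
  proof cases
    case 1
    have "bump_deriv 0 = (\<lambda>t. - (bump t ^ 5) / 10)" by auto
    then show ?thesis using 1 by (auto intro!: continuous_intros)
  next
    case 2
    have "bump_deriv 1 = (\<lambda>t. t * bump t ^ 4)" by auto
    then show ?thesis using 2 by (auto intro!: continuous_intros)
  next
    case 3
    have "bump_deriv 2 = (\<lambda>t. bump t ^ 4 - 8 * t\<^sup>2 * bump t ^ 3)" by (auto simp: numeral_2_eq_2)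
    then show ?thesis using 3 by (auto intro!: continuous_intros)
  next
    case 4
    have "bump_deriv 3 = (\<lambda>t. - 24 * t * bump t ^ 3 + 48 * t ^ 3 * bump t ^ 2)" by (auto simp: numeral_3_eq_3)
    then show ?thesis using 4 by (auto intro!: continuous_intros)
  next
    case 5
    have "bump_deriv k = (\<lambda>t. - 24 * bump t ^ 3 + 288 * t\<^sup>2 * bump t ^ 2 - 192 * t ^ 4 * bump t)" using 5 by auto
    then show ?thesis by (auto intro!: continuous_intros)
  qed
qed

lemma bump_deriv_eq_0: "1 \<le> \<bar>t\<bar> \<Longrightarrow> bump_deriv k t = 0"
  by (induction k t rule: bump_deriv.induct) (auto simp: bump_eq_0)

text \<open>\<open>504 = 24 + 288 + 192\<close> is the sum of the absolute coefficients at order 4,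
  the largest such sum; on \<open>\<bar>t\<bar> \<le> 1\<close> every monomial is at most 1.\<close>

lemma abs_bump_deriv_le: "\<bar>bump_deriv k t\<bar> \<le> 504"
proof (cases "\<bar>t\<bar> \<le> 1")
  case True
  have b: "\<bar>t ^ i * bump t ^ j\<bar> \<le> 1" for i j
    using True by (auto simp: abs_mult power_abs bump_nonneg intro!: mult_le_one power_le_one bump_le_1)
  have b0: "\<bar>bump t ^ j\<bar> \<le> 1" and b1: "\<bar>t * bump t ^ j\<bar> \<le> 1" and b4: "\<bar>t ^ j * bump t\<bar> \<le> 1" for j
    using b[of 0 j] b[of 1 j] b[of j 1] by simp_all
  consider "k = 0" | "k = 1" | "k = 2" | "k = 3" | j where "k = Suc (Suc (Suc (Suc j)))"
    by (metis One_nat_def Suc_1 numeral_3_eq_3 old.nat.exhaust)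
  then show ?thesis
  proof cases
    case 1 then show ?thesis using b0[of 5] by simp
  next
    case 2 then show ?thesis using b1[of 4] by simp
  next
    case 3
    then have "bump_deriv k t = bump t ^ 4 - 8 * (t\<^sup>2 * bump t ^ 3)" by (simp add: numeral_2_eq_2)
    then show ?thesis using b0[of 4] b[of 2 3] by linarith
  next
    case 4
    then have "bump_deriv k t = - 24 * (t * bump t ^ 3) + 48 * (t ^ 3 * bump t ^ 2)" by (simp add: numeral_3_eq_3)
    then show ?thesis using b1[of 3] b[of 3 2] by linarith
  next
    case 5
    then have "bump_deriv k t = - 24 * bump t ^ 3 + 288 * (t\<^sup>2 * bump t ^ 2) - 192 * (t ^ 4 * bump t)" by simp
    then show ?thesis using b0[of 3] b[of 2 2] b4[of 4] by linarith
  qed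
qed (simp add: bump_deriv_eq_0)

section \<open>Almost orthogonality of lines\<close>

text \<open>The window \<open>{-1..1}\<close> loses nothing, since \<open>bump_deriv j\<close>
  vanishes outside it: this is the correlation over the whole line.\<close>

definition autocorr :: "nat \<Rightarrow> nat \<Rightarrow> real \<Rightarrow> real" where
  "autocorr j k v = integral {-1..1} (\<lambda>t. bump_deriv j t * bump_deriv k (t + v))"

lemma continuous_on_bump_deriv_compose [continuous_intros]:
  "continuous_on S f \<Longrightarrow> continuous_on S (\<lambda>x. bump_deriv k (f x))"
  using continuous_on_compose2[OF continuous_on_bump_deriv[of UNIV k], of S f] by simp

text \<open>The shift \<open>v\<close> occurs in the second factor only, so differentiation under
  the integral raises only the second index. Read backwards, lowering that index produces
  antiderivatives.\<close>

lemma has_field_derivative_autocorr: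
  assumes "k < 4"
  shows "(autocorr j k has_field_derivative autocorr j (Suc k) v) (at v)"
proof -
  have "((\<lambda>v. integral (cbox (-1) 1) (\<lambda>t. bump_deriv j t * bump_deriv k (t + v))) has_field_derivative
        integral (cbox (-1) 1) (\<lambda>t. bump_deriv j t * bump_deriv (Suc k) (t + v))) (at v within UNIV)"
  proof (rule leibniz_rule_field_derivative)
    show "((\<lambda>x. bump_deriv j t * bump_deriv k (t + x)) has_field_derivative bump_deriv j t * bump_deriv (Suc k) (t + x)) (at x within UNIV)" for x t
    proof -
      have "((\<lambda>x. t + x) has_field_derivative 1) (at x)" by (auto intro!: derivative_eq_intros)
      from DERIV_cmult[OF DERIV_chain2[where f = "bump_deriv k", OF has_field_derivative_bump_deriv[OF assms] this], of "bump_deriv j t"]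
      show ?thesis by simp
    qed
    show "(\<lambda>t. bump_deriv j t * bump_deriv k (t + x)) integrable_on cbox (-1) 1" for x
      by (intro integrable_continuous continuous_intros continuous_on_bump_deriv)
    show "continuous_on (UNIV \<times> cbox (-1) 1) (\<lambda>(x, t). bump_deriv j t * bump_deriv (Suc k) (t + x))"
      by (auto simp: case_prod_unfold intro!: continuous_intros)
  qed auto
  then show ?thesis by (simp add: autocorr_def[abs_def])
qed

lemma abs_autocorr_le: "\<bar>autocorr j k v\<bar> \<le> 2 * 504\<^sup>2"
proof -
  have "norm (integral {-1..1} (\<lambda>t. bump_deriv j t * bump_deriv k (t + v))) \<le> 504\<^sup>2 * (1 - (-1))"
  proof (rule integral_bound)
    show "norm (bump_deriv j t * bump_deriv k (t + v)) \<le> 504\<^sup>2" for t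
      using mult_mono[OF abs_bump_deriv_le[of j t] abs_bump_deriv_le[of k "t+v"]] by (simp add: abs_mult power2_eq_square)
  qed (auto intro!: continuous_intros continuous_on_bump_deriv)
  then show ?thesis by (simp add: autocorr_def)
qed

lemma autocorr_eq_0:
  assumes "2 \<le> \<bar>v\<bar>"
  shows "autocorr j k v = 0"
proof -
  have "bump_deriv j t * bump_deriv k (t + v) = 0" for t
    using assms bump_deriv_eq_0[of t j] bump_deriv_eq_0[of "t + v" k] by (cases "1 \<le> \<bar>t\<bar>") auto
  then show ?thesis unfolding autocorr_def by (simp only: integral_0)
qed

lemma continuous_on_autocorr [continuous_intros]:
  assumes "continuous_on S f"
  shows "continuous_on S (\<lambda>x. autocorr j k (f x))"
proof -
  have "continuous_on UNIV (\<lambda>v. integral (cbox (-1) 1) (\<lambda>t. bump_deriv j t * bump_deriv k (t + v)))"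
    by (rule integral_continuous_on_param) (auto simp: case_prod_unfold intro!: continuous_intros)
  then have "continuous_on UNIV (autocorr j k)" by (simp add: autocorr_def[abs_def])
  from continuous_on_compose2[OF this assms] show ?thesis by simp
qed

text \<open>The integral is a difference of two values of one continuous antiderivative. This
  supplies the integrability of averages over the widening parameter \<open>u\<close>.\<close>

lemma continuous_on_integral_widening:
  fixes g :: "real \<Rightarrow> real"
  assumes g: "continuous_on {-1..3} g"
  shows "continuous_on {0..1} (\<lambda>u. integral {-u..2+u} g)"
proof -
  define G where "G z = integral {-1..z} g" for z
  have int: "g integrable_on {-1..3}" using g by (rule integrable_continuous_real)
  have G: "continuous_on {-1..3} G"
    unfolding G_def by (rule indefinite_integral_continuous_1[OF int])
  have eq: "G (2+u) - G (-u) = integral {-u..2+u} g" if "u \<in> {0..1}" for u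
  proof -
    have "integral {-1..-u} g + integral {-u..2+u} g = integral {-1..2+u} g"
      using that by (intro Henstock_Kurzweil_Integration.integral_combine integrable_subinterval_real[OF int]) auto
    then show ?thesis by (simp add: G_def)
  qed
  have "continuous_on {0..1} (\<lambda>u. G (2+u) - G (-u))"
    by (intro continuous_intros continuous_on_compose2[OF G]) auto
  then show ?thesis by (rule continuous_on_eq) (rule eq)
qed

text \<open>Averaging over \<open>u\<close> turns the sharp cutoff in \<open>x\<close> into a Lipschitz one; this is what makes
  the second antiderivative available and yields quadratic decay in \<open>w / A\<close>.\<close>

definition line_kernel :: "nat \<Rightarrow> real \<Rightarrow> real \<Rightarrow> real \<Rightarrow> real" where
  "line_kernel j w A c = integral {0..1} (\<lambda>u. integral {-u..2+u} (\<lambda>x. autocorr j j ((A * x + c) / w)))"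

text \<open>The trivial bound, for nearly parallel lines: the \<open>x\<close>-interval has length
  at most 4 and the integrand is at most \<open>2 * 504\<^sup>2\<close>.\<close>

lemma abs_line_kernel_le_const: "\<bar>line_kernel j w A c\<bar> \<le> 8 * 504\<^sup>2"
proof -
  let ?g = "\<lambda>x. autocorr j j ((A * x + c) / w)"
  have cont: "continuous_on S ?g" for S by (cases "w = 0") (auto intro!: continuous_intros)
  have inner: "norm (integral {-u..2+u} ?g) \<le> 8 * 504\<^sup>2" if "u \<in> {0..1}" for u
  proof -
    have "norm (integral {-u..2+u} ?g) \<le> 2 * 504\<^sup>2 * (2 + u - (-u))"
    proof (rule integral_bound[OF _ cont])
      show "norm (autocorr j j ((A * t + c) / w)) \<le> 2 * 504\<^sup>2" for t
        by (simp only: real_norm_def abs_autocorr_le)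
    qed (use that in auto)
    then show ?thesis using that by auto
  qed
  have "norm (integral {0..1} (\<lambda>u. integral {-u..2+u} ?g)) \<le> 8 * 504\<^sup>2 * (1 - 0)"
    by (rule integral_bound) (use inner in \<open>auto intro!: continuous_on_integral_widening cont\<close>)
  then show ?thesis by (simp add: line_kernel_def)
qed

text \<open>For \<open>j \<ge> 2\<close>, \<open>autocorr j j\<close> is the second derivative of
  \<open>autocorr j (j - 2)\<close>. Integration in \<open>x\<close> and then in \<open>u\<close> is
  therefore exact, and each gains a factor \<open>w / A\<close>.\<close>

lemma abs_line_kernel_le_square:
  assumes w: "0 < w" and A: "A \<noteq> 0" and j: "2 \<le> j" "j \<le> 4"
  shows "\<bar>line_kernel j w A c\<bar> \<le> 8 * 504\<^sup>2 * (w / A)\<^sup>2"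
proof -
  obtain k where k: "j = Suc (Suc k)" "k < 4" "Suc k < 4"
    using j by (metis Suc_1 Suc_le_D Suc_le_eq eval_nat_numeral(2) le_SucI less_Suc_eq_le numeral_2_eq_2 numeral_3_eq_3 semiring_norm(26) semiring_norm(27))
  have S: "((\<lambda>x. autocorr j i (f x)) has_field_derivative autocorr j (Suc i) (f x) * D) (at x within Z)"
    if "i < 4" "(f has_field_derivative D) (at x within Z)" for i f D x Z
    using DERIV_chain2[OF has_field_derivative_autocorr[OF that(1)] that(2)] .
  have inner: "integral {-u..2+u} (\<lambda>x. autocorr j j ((A * x + c) / w)) =
      w / A * (autocorr j (Suc k) ((A * (2+u) + c) / w) - autocorr j (Suc k) ((A * (-u) + c) / w))" if "u \<in> {0..1}" for u
  proof -
    have "((\<lambda>x. autocorr j j ((A * x + c) / w)) has_integral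
       (w / A * autocorr j (Suc k) ((A * (2+u) + c) / w) - w / A * autocorr j (Suc k) ((A * (-u) + c) / w))) {-u..2+u}"
    proof (rule fundamental_theorem_of_calculus)
      fix x
      have "((\<lambda>x. (A * x + c) / w) has_field_derivative A / w) (at x within {-u..2+u})"
        using w by (auto intro!: derivative_eq_intros)
      from DERIV_cmult[OF S[OF k(3) this], of "w / A"]
      show "((\<lambda>x. w / A * autocorr j (Suc k) ((A * x + c) / w)) has_vector_derivative autocorr j j ((A * x + c) / w))
          (at x within {-u..2+u})"
        using w A k by (simp add: has_real_derivative_iff_has_vector_derivative)
    qed (use that in auto)
    then show ?thesis by (simp add: integral_unique right_diff_distrib)
  qed
  define T where "T z = autocorr j k (z / w)" for z
  have "((\<lambda>u. w / A * (autocorr j (Suc k) ((A * (2+u) + c) / w) - autocorr j (Suc k) ((A * (-u) + c) / w))) has_integral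
     ((w / A)\<^sup>2 * (T (A * (2+1) + c) + T (A * (-1) + c)) - (w / A)\<^sup>2 * (T (A * (2+0) + c) + T (A * (-0) + c)))) {0..1}"
  proof (rule fundamental_theorem_of_calculus)
    fix u
    have "((\<lambda>u. (A * (2+u) + c) / w) has_field_derivative A / w) (at u within {0..1})"
         "((\<lambda>u. (A * (-u) + c) / w) has_field_derivative - A / w) (at u within {0..1})"
      using w by (auto intro!: derivative_eq_intros)
    from DERIV_cmult[OF DERIV_add[OF S[OF k(2) this(1)] S[OF k(2) this(2)]], of "(w / A)\<^sup>2"]
    show "((\<lambda>u. (w / A)\<^sup>2 * (T (A * (2+u) + c) + T (A * (-u) + c))) has_vector_derivative
        w / A * (autocorr j (Suc k) ((A * (2+u) + c) / w) - autocorr j (Suc k) ((A * (-u) + c) / w))) (at u within {0..1})"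
      unfolding T_def has_real_derivative_iff_has_vector_derivative[symmetric]
      by (rule DERIV_cong) (use w A in \<open>simp add: power2_eq_square field_simps\<close>)
  qed auto
  moreover have "line_kernel j w A c = integral {0..1} (\<lambda>u. w / A * (autocorr j (Suc k) ((A * (2+u) + c) / w) - autocorr j (Suc k) ((A * (-u) + c) / w)))"
    unfolding line_kernel_def by (rule integral_cong) (rule inner)
  ultimately have "line_kernel j w A c = (w / A)\<^sup>2 * (T (A * (2+1) + c) + T (A * (-1) + c)) - (w / A)\<^sup>2 * (T (A * (2+0) + c) + T (A * (-0) + c))"
    by (simp only: integral_unique)
  also have "\<dots> = (w / A)\<^sup>2 * (T (A * (2+1) + c) + T (A * (-1) + c) - T (A * (2+0) + c) - T (A * (-0) + c))"
    by (simp add: algebra_simps)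
  also have "\<bar>\<dots>\<bar> \<le> (w / A)\<^sup>2 * (8 * 504\<^sup>2)"
  proof -
    have "\<bar>T z\<bar> \<le> 2 * 504\<^sup>2" for z by (simp only: T_def abs_autocorr_le)
    \<comment> \<open>Two endpoints in \<open>x\<close> times two in \<open>u\<close> leave four
      boundary terms, each at most \<open>2 * 504\<^sup>2\<close>.\<close>
    from this[of "A * (2+1) + c"] this[of "A * (-1) + c"] this[of "A * (2+0) + c"] this[of "A * (-0) + c"]
    have "\<bar>T (A * (2+1) + c) + T (A * (-1) + c) - T (A * (2+0) + c) - T (A * (-0) + c)\<bar> \<le> 8 * 504\<^sup>2"
      by linarith
    then show ?thesis unfolding abs_mult abs_power2 by (rule mult_left_mono) simp
  qed
  finally show ?thesis by (simp add: mult.commute)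
qed

text \<open>All \<open>x\<close> involved satisfy \<open>\<bar>x\<bar> \<le> 3\<close>, so
  throughout that range the two lines are at vertical distance at least \<open>2 * w\<close>, and
  their strips of half-width \<open>w\<close> have no interior overlap.\<close>

lemma line_kernel_eq_0:
  assumes w: "0 < w" and c: "3 * \<bar>A\<bar> + 2 * w \<le> \<bar>c\<bar>"
  shows "line_kernel j w A c = 0"
proof -
  have *: "integral {-u..2+u} (\<lambda>x. autocorr j j ((A * x + c) / w)) = integral {-u..2+u} (\<lambda>x. 0)" if "u \<in> {0..1}" for u
  proof (rule integral_cong)
    fix x assume "x \<in> {-u..2+u}"
    then have "\<bar>x\<bar> \<le> 3" using that by auto
    then have "\<bar>A * x\<bar> \<le> 3 * \<bar>A\<bar>" by (simp add: abs_mult mult.commute mult_left_mono)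
    then have "2 * w \<le> \<bar>A * x + c\<bar>" using c by linarith
    then show "autocorr j j ((A * x + c) / w) = 0"
      using w by (intro autocorr_eq_0) (simp add: field_simps)
  qed
  have "line_kernel j w A c = integral {0..1} (\<lambda>u::real. 0)"
    unfolding line_kernel_def by (rule integral_cong) (simp add: *)
  then show ?thesis by simp
qed

text \<open>Substitute \<open>t = (y - p) / w\<close>. The bounds on \<open>p\<close> and
  \<open>w\<close> keep the support \<open>{p - w..p + w}\<close> inside
  \<open>{-10..10}\<close>.\<close>

lemma integral_bump_deriv_mult_bump_deriv:
  assumes w: "0 < w" "w \<le> 1" and p: "\<bar>p\<bar> \<le> 9"
  shows "((\<lambda>y. bump_deriv j ((y - p) / w) * bump_deriv j ((y - q) / w)) has_integral w * autocorr j j ((p - q) / w)) {-10..10}"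
proof -
  have "((\<lambda>t. bump_deriv j t * bump_deriv j (t + (p - q) / w)) has_integral autocorr j j ((p - q) / w)) (cbox (-1) 1)"
    unfolding autocorr_def cbox_interval
    by (intro integrable_integral integrable_continuous_real continuous_intros continuous_on_bump_deriv)
  from has_integral_affinity'[OF this, of "1 / w" "- p / w"] w
  have *: "((\<lambda>y. bump_deriv j ((1 / w) *\<^sub>R y + - p / w) * bump_deriv j ((1 / w) *\<^sub>R y + - p / w + (p - q) / w)) has_integral
      (autocorr j j ((p - q) / w) /\<^sub>R (1 / w) ^ DIM(real)))
      (cbox ((-1 - (- p / w)) /\<^sub>R (1 / w)) ((1 - (- p / w)) /\<^sub>R (1 / w)))"
    by simp
  have eqs: "(1 / w) *\<^sub>R y + - p / w = (y - p) / w"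
    "(y - p) / w + (p - q) / w = (y - q) / w"
    "v /\<^sub>R (1 / w) ^ DIM(real) = w * v" "(-1 - (- p / w)) /\<^sub>R (1 / w) = p - w" "(1 - (- p / w)) /\<^sub>R (1 / w) = p + w"
    for y v :: real using w by (simp_all add: field_simps)
  have "((\<lambda>y. bump_deriv j ((y - p) / w) * bump_deriv j ((y - q) / w)) has_integral w * autocorr j j ((p - q) / w)) {p - w..p + w}"
    using *[unfolded eqs] by simp
  then show ?thesis
  proof (rule has_integral_on_superset)
    fix y assume "y \<notin> {p - w..p + w}"
    then have "1 \<le> \<bar>(y - p) / w\<bar>" using w by (auto simp: abs_if field_simps)
    then show "bump_deriv j ((y - p) / w) * bump_deriv j ((y - q) / w) = 0" by (simp add: bump_deriv_eq_0)
  qed (use w p in auto)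
qed

text \<open>Expanding the square and integrating in \<open>y\<close> gives correlations of pairs of
  lines. The result \<open>E x\<close> is nonnegative, so the range \<open>{0..2}\<close> may be
  widened to \<open>{-u..2+u}\<close> and averaged over \<open>u\<close>, which produces
  \<open>line_kernel\<close>.\<close>

lemma energy_le:
  fixes a b c :: "'l \<Rightarrow> real"
  assumes w: "0 < w" "w \<le> 1" and L: "finite L" and ab: "\<And>l. l \<in> L \<Longrightarrow> \<bar>a l\<bar> \<le> 2 \<and> \<bar>b l\<bar> \<le> 3"
  shows "integral {0..2} (\<lambda>x. integral {-10..10} (\<lambda>y. (\<Sum>l\<in>L. c l * bump_deriv j ((y - a l * x - b l) / w))\<^sup>2))
    \<le> (\<Sum>l\<in>L. \<Sum>l'\<in>L. \<bar>c l\<bar> * \<bar>c l'\<bar> * (w * \<bar>line_kernel j w (a l - a l') (b l - b l')\<bar>))"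
proof -
  define E where "E x = (\<Sum>l\<in>L. \<Sum>l'\<in>L. c l * c l' * (w * autocorr j j (((a l - a l') * x + (b l - b l')) / w)))" for x
  have E: "((\<lambda>y. (\<Sum>l\<in>L. c l * bump_deriv j ((y - a l * x - b l) / w))\<^sup>2) has_integral E x) {-10..10}"
    if "x \<in> {-1..3}" for x
  proof -
    have "((\<lambda>y. c l * c l' * (bump_deriv j ((y - (a l * x + b l)) / w) * bump_deriv j ((y - (a l' * x + b l')) / w))) has_integral
        c l * c l' * (w * autocorr j j (((a l - a l') * x + (b l - b l')) / w))) {-10..10}" if "l \<in> L" for l l'
    proof -
      have "\<bar>a l * x\<bar> \<le> 2 * 3" unfolding abs_mult
        by (rule mult_mono) (use ab[OF that] \<open>x \<in> _\<close> in auto)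
      then have "\<bar>a l * x + b l\<bar> \<le> 9" using ab[OF that] by linarith
      from has_integral_mult_right[OF integral_bump_deriv_mult_bump_deriv[OF w this, of j "a l' * x + b l'"], of "c l * c l'"]
      show ?thesis by (simp add: algebra_simps)
    qed
    then have "((\<lambda>y. \<Sum>l\<in>L. \<Sum>l'\<in>L. c l * c l' * (bump_deriv j ((y - (a l * x + b l)) / w) * bump_deriv j ((y - (a l' * x + b l')) / w)))
        has_integral E x) {-10..10}"
      unfolding E_def by (intro has_integral_sum L)
    moreover have "(\<Sum>l\<in>L. c l * bump_deriv j ((y - a l * x - b l) / w))\<^sup>2 =
       (\<Sum>l\<in>L. \<Sum>l'\<in>L. c l * c l' * (bump_deriv j ((y - (a l * x + b l)) / w) * bump_deriv j ((y - (a l' * x + b l')) / w)))" for y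
      unfolding power2_eq_square sum_product by (intro sum.cong refl) (simp add: algebra_simps)
    ultimately show ?thesis by simp
  qed
  have contE: "continuous_on {-1..3} E" unfolding E_def
    using w by (intro continuous_intros) auto
  have nonneg: "0 \<le> E x" if "x \<in> {-1..3}" for x
    by (rule has_integral_nonneg[OF E[OF that]]) simp
  have intE: "E integrable_on {u..v}" if "{u..v} \<subseteq> {-1..3}" for u v
    using continuous_on_subset[OF contE that] by (rule integrable_continuous_real)
  have "integral {0..2} (\<lambda>x. integral {-10..10} (\<lambda>y. (\<Sum>l\<in>L. c l * bump_deriv j ((y - a l * x - b l) / w))\<^sup>2)) = integral {0..2} E"
    by (intro integral_cong integral_unique E) auto
  also have "\<dots> = integral {0..1} (\<lambda>u::real. integral {0..2} E)" by simp
  also have "\<dots> \<le> integral {0..1} (\<lambda>u. integral {-u..2+u} E)"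
  proof (rule integral_le)
    show "(\<lambda>u. integral {-u..2+u} E) integrable_on {0..1}"
      by (intro integrable_continuous_real continuous_on_integral_widening contE)
    show "integral {0..2} E \<le> integral {-u..2+u} E" if "u \<in> {0..1}" for u
      using that by (intro integral_subset_le intE) (auto intro!: nonneg)
  qed auto
  also have "\<dots> = integral {0..1} (\<lambda>u. \<Sum>l\<in>L. \<Sum>l'\<in>L. c l * c l' * (w * integral {-u..2+u} (\<lambda>x. autocorr j j (((a l - a l') * x + (b l - b l')) / w))))"
  proof (rule integral_cong)
    fix u :: real
    have "(E has_integral (\<Sum>l\<in>L. \<Sum>l'\<in>L. c l * c l' * (w * integral {-u..2+u} (\<lambda>x. autocorr j j (((a l - a l') * x + (b l - b l')) / w))))) {-u..2+u}"
      unfolding E_def using w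
      by (intro has_integral_sum L has_integral_mult_right integrable_integral integrable_continuous_real continuous_intros) auto
    then show "integral {-u..2+u} E = (\<Sum>l\<in>L. \<Sum>l'\<in>L. c l * c l' * (w * integral {-u..2+u} (\<lambda>x. autocorr j j (((a l - a l') * x + (b l - b l')) / w))))"
      by (rule integral_unique)
  qed
  also have "\<dots> = (\<Sum>l\<in>L. \<Sum>l'\<in>L. c l * c l' * (w * line_kernel j w (a l - a l') (b l - b l')))"
    unfolding line_kernel_def using w
    by (intro integral_unique has_integral_sum L has_integral_mult_right integrable_integral integrable_continuous_real
        continuous_on_integral_widening continuous_intros) auto
  also have "\<dots> \<le> (\<Sum>l\<in>L. \<Sum>l'\<in>L. \<bar>c l\<bar> * \<bar>c l'\<bar> * (w * \<bar>line_kernel j w (a l - a l') (b l - b l')\<bar>))"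
  proof (intro sum_mono)
    fix l l'
    have "c l * c l' * (w * line_kernel j w (a l - a l') (b l - b l')) \<le> \<bar>c l * c l' * (w * line_kernel j w (a l - a l') (b l - b l'))\<bar>"
      by simp
    then show "c l * c l' * (w * line_kernel j w (a l - a l') (b l - b l')) \<le> \<bar>c l\<bar> * \<bar>c l'\<bar> * (w * \<bar>line_kernel j w (a l - a l') (b l - b l')\<bar>)"
      using w by (simp only: abs_mult abs_of_pos)
  qed
  finally show ?thesis .
qed

text \<open>Dyadic decomposition by slope difference: at scale \<open>2 ^ i * w\<close> there are at
  most \<open>M * 4 ^ i\<close> lines that interact with \<open>l\<close>, each with kernel of order
  \<open>1 / 4 ^ i\<close>. Every one of the \<open>J + 1\<close> scales thus contributes
  equally.\<close>

lemma sum_abs_line_kernel_le: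
  fixes a b :: "'l \<Rightarrow> real"
  assumes w: "0 < w" and L: "finite L" "l \<in> L" and a: "\<And>l. l \<in> L \<Longrightarrow> \<bar>a l\<bar> \<le> 2" and j: "2 \<le> j" "j \<le> 4"
    and cnt: "\<And>r. w \<le> r \<Longrightarrow> real (card {l' \<in> L. \<bar>a l' - a l\<bar> \<le> r \<and> \<bar>b l' - b l\<bar> \<le> 5 * r}) \<le> M * (r / w)\<^sup>2"
    and J: "4 \<le> 2 ^ J * w"
  shows "(\<Sum>l'\<in>L. \<bar>line_kernel j w (a l - a l') (b l - b l')\<bar>) \<le> 32 * 504\<^sup>2 * M * (real J + 1)"
proof -
  define D where "D i = {l' \<in> L. \<bar>a l' - a l\<bar> \<le> 2 ^ i * w \<and> \<bar>b l' - b l\<bar> \<le> 5 * (2 ^ i * w)}" for i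
  have cD: "real (card (D i)) \<le> M * 4 ^ i" for i
  proof -
    have "w \<le> 2 ^ i * w" using w by simp
    from cnt[OF this] show ?thesis using w by (simp add: D_def power_mult[symmetric] power2_eq_square flip: power_mult_distrib)
  qed
  have pt: "\<bar>line_kernel j w (a l - a l') (b l - b l')\<bar> \<le> (\<Sum>i\<le>J. if l' \<in> D i then 32 * 504\<^sup>2 / 4 ^ i else 0)"
    if l': "l' \<in> L" for l'
  proof (cases "line_kernel j w (a l - a l') (b l - b l') = 0")
    case True then show ?thesis by (auto intro!: sum_nonneg)
  next
    case False
    let ?A = "\<bar>a l' - a l\<bar>"
    have "?A \<le> 2 ^ J * w" using a[OF l'] a[OF L(2)] J by linarith
    \<comment> \<open>The least such scale: for \<open>i > 0\<close> minimality gives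
      \<open>?A > 2 ^ (i - 1) * w\<close>, which feeds the quadratic decay. The lost factor 2 is
      squared, whence \<open>32 = 8 * 4\<close>.\<close>
    then obtain i where i: "?A \<le> 2 ^ i * w" "\<And>k. k < i \<Longrightarrow> \<not> ?A \<le> 2 ^ k * w" "i \<le> J"
      using exists_least_iff[of "\<lambda>i. ?A \<le> 2 ^ i * w"] by (metis not_le_imp_less)
    have w2: "w \<le> 2 ^ i * w" using w by simp
    \<comment> \<open>A nonzero kernel means that the strips meet, so closeness of the slopes forces
      closeness of the intercepts.\<close>
    have "\<bar>b l - b l'\<bar> < 3 * \<bar>a l - a l'\<bar> + 2 * w"
      using line_kernel_eq_0[OF w, of "a l - a l'" "b l - b l'" j] False by linarith
    also have "\<dots> \<le> 3 * (2 ^ i * w) + 2 * (2 ^ i * w)"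
      using i(1) w2 by (intro add_mono mult_left_mono) (auto simp: abs_minus_commute)
    finally have "\<bar>b l' - b l\<bar> \<le> 5 * (2 ^ i * w)" by (simp add: abs_minus_commute mult.commute)
    then have D: "l' \<in> D i" using l' i(1) by (simp add: D_def)
    have "\<bar>line_kernel j w (a l - a l') (b l - b l')\<bar> \<le> 32 * 504\<^sup>2 / 4 ^ i"
    proof (cases i)
      case 0
      then show ?thesis using abs_line_kernel_le_const[of j w "a l - a l'" "b l - b l'"] by simp
    next
      case (Suc k)
      then have A: "2 ^ k * w < ?A" using i(2)[of k] by simp
      then have A0: "a l - a l' \<noteq> 0" using w by (smt (verit) mult_pos_pos zero_less_power)
      have "(w / (a l - a l'))\<^sup>2 = (w / ?A)\<^sup>2" by (simp add: power_divide power2_commute)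
      also have "\<dots> \<le> (1 / 2 ^ k)\<^sup>2"
        using A w A0 by (intro power_mono) (auto simp: field_simps)
      also have "\<dots> = 4 / 4 ^ i" by (simp add: Suc power_divide power2_eq_square flip: power_mult_distrib)
      finally have "8 * 504\<^sup>2 * (w / (a l - a l'))\<^sup>2 \<le> 8 * 504\<^sup>2 * (4 / 4 ^ i)"
        by (rule mult_left_mono) simp
      with abs_line_kernel_le_square[OF w A0 j, of "b l - b l'"] show ?thesis by simp
    qed
    also have "\<dots> = (if l' \<in> D i then 32 * 504\<^sup>2 / 4 ^ i else 0)" using D by simp
    also have "\<dots> \<le> (\<Sum>i\<le>J. if l' \<in> D i then 32 * 504\<^sup>2 / 4 ^ i else 0)"
      using i(3) by (intro member_le_sum) auto
    finally show ?thesis .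
  qed
  have "(\<Sum>l'\<in>L. \<bar>line_kernel j w (a l - a l') (b l - b l')\<bar>) \<le> (\<Sum>l'\<in>L. \<Sum>i\<le>J. if l' \<in> D i then 32 * 504\<^sup>2 / 4 ^ i else 0)"
    by (intro sum_mono pt)
  also have "\<dots> = (\<Sum>i\<le>J. \<Sum>l'\<in>L. if l' \<in> D i then 32 * 504\<^sup>2 / 4 ^ i else 0)" by (rule sum.swap)
  also have "\<dots> = (\<Sum>i\<le>J. real (card (D i)) * (32 * 504\<^sup>2 / 4 ^ i))"
  proof (intro sum.cong refl)
    fix i
    have "(\<Sum>l'\<in>L. if l' \<in> D i then 32 * 504\<^sup>2 / 4 ^ i else 0) = (\<Sum>l'\<in>D i. 32 * 504\<^sup>2 / (4::real) ^ i)"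
      using L(1) by (intro sum.mono_neutral_cong_right) (auto simp: D_def)
    then show "(\<Sum>l'\<in>L. if l' \<in> D i then 32 * 504\<^sup>2 / 4 ^ i else 0) = real (card (D i)) * (32 * 504\<^sup>2 / 4 ^ i)" by simp
  qed
  also have "\<dots> \<le> (\<Sum>i\<le>J. M * 4 ^ i * (32 * 504\<^sup>2 / 4 ^ i))"
    by (intro sum_mono mult_right_mono cD) simp
  also have "\<dots> = 32 * 504\<^sup>2 * M * (real J + 1)" by simp
  finally show ?thesis .
qed

section \<open>Pointwise bounds by local square integrals, and the high-frequency estimate\<close>

text \<open>A one-dimensional Sobolev inequality: integrate the derivative of
  \<open>- \<theta> * f\<^sup>2\<close>, where the weight \<open>\<theta>\<close> falls linearly
  from 1 at \<open>x\<close> to 0 at \<open>x + w\<close>, and split the mixed term.\<close>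

lemma square_le_integral:
  fixes f f' :: "real \<Rightarrow> real"
  assumes w: "0 < w" and f: "\<And>t. (f has_field_derivative f' t) (at t)" and f': "continuous_on UNIV f'"
  shows "(f x)\<^sup>2 \<le> integral {x..x+w} (\<lambda>t. 2 / w * (f t)\<^sup>2 + w * (f' t)\<^sup>2)"
proof -
  have contf: "continuous_on S f" for S
    by (meson DERIV_isCont continuous_at_imp_continuous_on f)
  have contf': "continuous_on S f'" for S using f' continuous_on_subset by blast
  define h where "h t = - ((1 - (t - x) / w) * (f t)\<^sup>2)" for t
  define h' where "h' t = (f t)\<^sup>2 / w - (1 - (t - x) / w) * (2 * f t * f' t)" for t
  have "(h' has_integral (h (x+w) - h x)) {x..x+w}"
  proof (rule fundamental_theorem_of_calculus)
    fix t
    have "(h has_field_derivative h' t) (at t)"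
      unfolding h_def h'_def using w by (auto intro!: derivative_eq_intros f simp: field_simps)
    then show "(h has_vector_derivative h' t) (at t within {x..x+w})"
      by (simp add: has_real_derivative_iff_has_vector_derivative[symmetric] has_field_derivative_at_within)
  qed (use w in simp)
  then have 1: "(h' has_integral (f x)\<^sup>2) {x..x+w}" using w by (simp add: h_def)
  show ?thesis
  proof (rule has_integral_le[OF 1 integrable_integral])
    show "(\<lambda>t. 2 / w * (f t)\<^sup>2 + w * (f' t)\<^sup>2) integrable_on {x..x+w}"
      by (intro integrable_continuous_real continuous_intros contf contf')
    fix t assume t: "t \<in> {x..x+w}"
    define \<theta> where "\<theta> = 1 - (t - x) / w"
    have th: "0 \<le> \<theta>" "\<theta> \<le> 1" using t w by (auto simp: \<theta>_def field_simps)
    \<comment> \<open>Expanding this square splits the mixed term \<open>f * f'\<close> with the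
      weights \<open>1 / w\<close> and \<open>w\<close>.\<close>
    have "0 \<le> (f t + \<theta> * w * f' t)\<^sup>2" by simp
    then have "- (\<theta> * (2 * f t * f' t)) * w \<le> (f t)\<^sup>2 + \<theta>\<^sup>2 * (w * f' t)\<^sup>2"
      by (simp add: power2_eq_square algebra_simps)
    also have "\<theta>\<^sup>2 * (w * f' t)\<^sup>2 \<le> 1 * (w * f' t)\<^sup>2"
      using th by (intro mult_right_mono power_le_one) auto
    finally have "- (\<theta> * (2 * f t * f' t)) * w \<le> ((f t)\<^sup>2 / w + w * (f' t)\<^sup>2) * w"
      using w by (simp add: power2_eq_square algebra_simps)
    then have "- (\<theta> * (2 * f t * f' t)) \<le> (f t)\<^sup>2 / w + w * (f' t)\<^sup>2"
      using w by (rule mult_right_le_imp_le)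
    then show "h' t \<le> 2 / w * (f t)\<^sup>2 + w * (f' t)\<^sup>2"
      unfolding h'_def \<theta>_def[symmetric] by simp
  qed
qed

lemma sum_square_le:
  fixes f :: "'a \<Rightarrow> real"
  assumes "finite S"
  shows "(\<Sum>p\<in>S. f p)\<^sup>2 \<le> real (card S) * (\<Sum>p\<in>S. (f p)\<^sup>2)"
  using Cauchy_Schwarz_ineq_sum[of "\<lambda>_. 1" f S] by simp

context
  fixes L :: "'l set" and a b :: "'l \<Rightarrow> real" and w :: real
  assumes w: "0 < w" "w \<le> 1" and finite_L: "finite L"
begin

text \<open>The weights \<open>c\<close> are carried along because differentiation in
  \<open>x\<close> multiplies the term of \<open>l\<close> by \<open>- a l\<close>.\<close>

private definition G :: "nat \<Rightarrow> ('l \<Rightarrow> real) \<Rightarrow> real \<Rightarrow> real \<Rightarrow> real" where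
  "G j c x y = (\<Sum>l\<in>L. c l * bump_deriv j ((y - a l * x - b l) / w))"

private lemma continuous_on_G:
  "continuous_on S f \<Longrightarrow> continuous_on S g \<Longrightarrow> continuous_on S (\<lambda>z. G j c (f z) (g z))"
  unfolding G_def using w by (intro continuous_intros) auto

private lemma G_deriv_x:
  assumes "j < 4"
  shows "((\<lambda>x. G j c x y) has_field_derivative - (G (Suc j) (\<lambda>l. c l * a l) x y / w)) (at x)"
proof -
  have "((\<lambda>x. c l * bump_deriv j ((y - a l * x - b l) / w)) has_field_derivative
        c l * (bump_deriv (Suc j) ((y - a l * x - b l) / w) * (- a l / w))) (at x)" for l
  proof -
    have "((\<lambda>x. (y - a l * x - b l) / w) has_field_derivative - a l / w) (at x)"
      using w by (auto intro!: derivative_eq_intros)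
    from DERIV_cmult[OF DERIV_chain2[where f = "bump_deriv j", OF has_field_derivative_bump_deriv[OF assms] this]]
    show ?thesis .
  qed
  from DERIV_sum[where S = L, OF this] show ?thesis
    unfolding G_def by (rule DERIV_cong) (simp add: sum_divide_distrib sum_negf mult_ac)
qed

private lemma G_deriv_y:
  assumes "j < 4"
  shows "((\<lambda>y. G j c x y) has_field_derivative G (Suc j) c x y / w) (at y)"
proof -
  have "((\<lambda>y. c l * bump_deriv j ((y - a l * x - b l) / w)) has_field_derivative
        c l * (bump_deriv (Suc j) ((y - a l * x - b l) / w) * (1 / w))) (at y)" for l
  proof -
    have "((\<lambda>y. (y - a l * x - b l) / w) has_field_derivative 1 / w) (at y)"
      using w by (auto intro!: derivative_eq_intros)
    from DERIV_cmult[OF DERIV_chain2[where f = "bump_deriv j", OF has_field_derivative_bump_deriv[OF assms] this]]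
    show ?thesis .
  qed
  from DERIV_sum[where S = L, OF this] show ?thesis
    unfolding G_def by (rule DERIV_cong) (simp add: sum_divide_distrib)
qed

text \<open>The integrand left after \<open>square_le_integral\<close> has been applied in
  \<open>x\<close> and in \<open>y\<close>; its coefficients \<open>4, 2, 2, 1\<close> are the
  products of the coefficients 2 and 1 from each application.\<close>

private definition H :: "real \<times> real \<Rightarrow> real" where
  "H z = 4 * (G 2 (\<lambda>_. 1) (fst z) (snd z))\<^sup>2 + 2 * (G 3 (\<lambda>_. 1) (fst z) (snd z))\<^sup>2
       + 2 * (G 3 a (fst z) (snd z))\<^sup>2 + (G 4 a (fst z) (snd z))\<^sup>2"

private lemma H_cont: "continuous_on S H"
  unfolding H_def by (intro continuous_intros continuous_on_G)

private lemma H_nonneg: "0 \<le> H z"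
  unfolding H_def by (intro add_nonneg_nonneg mult_nonneg_nonneg) auto

text \<open>A two-dimensional Sobolev inequality on a square of side \<open>w\<close>. Each
  derivative costs \<open>1 / w\<close>, which its weight in \<open>square_le_integral\<close>
  compensates, so all powers of \<open>w\<close> collect into \<open>1 / w\<^sup>2\<close>.\<close>

private lemma G_square_le: "(G 2 (\<lambda>_. 1) x y)\<^sup>2 \<le> integral (cbox (x, y) (x+w, y+w)) H / w\<^sup>2"
proof -
  define g where "g t = 2 / w * (G 2 (\<lambda>_. 1) t y)\<^sup>2 + w * (- (G 3 a t y / w))\<^sup>2" for t
  have gb: "g t \<le> integral {y..y+w} (\<lambda>s. H (t, s)) / w\<^sup>2" for t
  proof -
    let ?u = "\<lambda>s. 2 / w * (G 2 (\<lambda>_. 1) t s)\<^sup>2 + w * (G 3 (\<lambda>_. 1) t s / w)\<^sup>2"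
    let ?v = "\<lambda>s. 2 / w * (G 3 a t s)\<^sup>2 + w * (G 4 a t s / w)\<^sup>2"
    have int: "?u integrable_on {y..y+w}" "?v integrable_on {y..y+w}"
      using w by (auto intro!: integrable_continuous_real continuous_intros continuous_on_G)
    have 1: "(G 2 (\<lambda>_. 1) t y)\<^sup>2 \<le> integral {y..y+w} ?u"
      using w G_deriv_y[of 2 "\<lambda>_. 1" t]
      by (intro square_le_integral) (auto intro!: continuous_intros continuous_on_G simp: eval_nat_numeral)
    have 2: "(G 3 a t y)\<^sup>2 \<le> integral {y..y+w} ?v"
      using w G_deriv_y[of 3 a t]
      by (intro square_le_integral) (auto intro!: continuous_intros continuous_on_G simp: eval_nat_numeral)
    have "g t = 2 / w * (G 2 (\<lambda>_. 1) t y)\<^sup>2 + 1 / w * (G 3 a t y)\<^sup>2"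
      using w by (simp add: g_def power2_eq_square)
    also have "\<dots> \<le> 2 / w * integral {y..y+w} ?u + 1 / w * integral {y..y+w} ?v"
      using w by (intro add_mono mult_left_mono 1 2) auto
    also have "\<dots> = integral {y..y+w} (\<lambda>s. 2 / w * ?u s + 1 / w * ?v s)"
      by (intro integral_unique[symmetric] has_integral_add has_integral_mult_right integrable_integral int)
    also have "\<dots> = integral {y..y+w} (\<lambda>s. H (t, s) * (1 / w\<^sup>2))"
      using w by (intro integral_cong) (simp add: H_def field_simps power2_eq_square)
    finally show ?thesis by simp
  qed
  have "(G 2 (\<lambda>_. 1) x y)\<^sup>2 \<le> integral {x..x+w} g"
    unfolding g_def using w G_deriv_x[of 2 "\<lambda>_. 1" y]
    by (intro square_le_integral) (auto intro!: continuous_intros continuous_on_G simp: eval_nat_numeral)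
  also have "\<dots> \<le> integral {x..x+w} (\<lambda>t. integral {y..y+w} (\<lambda>s. H (t, s)) / w\<^sup>2)"
  proof (rule integral_le[OF _ _ gb])
    show "g integrable_on {x..x+w}" unfolding g_def using w
      by (auto intro!: integrable_continuous_real continuous_intros continuous_on_G)
    have "continuous_on {x..x+w} (\<lambda>t. integral (cbox y (y+w)) (\<lambda>s. H (t, s)))"
      by (rule integral_continuous_on_param) (simp add: case_prod_unfold H_cont)
    then show "(\<lambda>t. integral {y..y+w} (\<lambda>s. H (t, s)) / w\<^sup>2) integrable_on {x..x+w}"
      using w by (intro integrable_continuous_real continuous_intros) auto
  qed
  also have "\<dots> = integral {x..x+w} (\<lambda>t. integral {y..y+w} (\<lambda>s. H (t, s))) / w\<^sup>2" by simp
  also have "integral {x..x+w} (\<lambda>t. integral {y..y+w} (\<lambda>s. H (t, s))) = integral (cbox (x, y) (x+w, y+w)) H"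
    using integral_prod_continuous[OF H_cont] by simp
  finally show ?thesis .
qed

text \<open>Cauchy-Schwarz over the points reduces to the squares of \<open>G 2\<close>. These are
  bounded by integrals of \<open>H\<close> over squares of side \<open>w\<close>, which overlap at
  most \<open>MP\<close> times, and the energy of the lines bounds the integral of \<open>H\<close>
  over a large box.\<close>

lemma high_frequency_bound:
  fixes P :: "'p set" and x y :: "'p \<Rightarrow> real"
  assumes P: "finite P" and xy: "\<And>p. p \<in> P \<Longrightarrow> 0 \<le> x p \<and> x p \<le> 1 \<and> 0 \<le> y p \<and> y p \<le> 1"
    and ab: "\<And>l. l \<in> L \<Longrightarrow> \<bar>a l\<bar> \<le> 2 \<and> \<bar>b l\<bar> \<le> 3"
    and cntP: "\<And>X Y. real (card {p \<in> P. X \<le> x p \<and> x p \<le> X + w \<and> Y \<le> y p \<and> y p \<le> Y + w}) \<le> MP"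
    and cntL: "\<And>l r. l \<in> L \<Longrightarrow> w \<le> r \<Longrightarrow>
      real (card {l' \<in> L. \<bar>a l' - a l\<bar> \<le> r \<and> \<bar>b l' - b l\<bar> \<le> 5 * r}) \<le> M * (r / w)\<^sup>2"
    and J: "4 \<le> 2 ^ J * w"
  shows "(\<Sum>p\<in>P. \<Sum>l\<in>L. bump_deriv 2 ((y p - a l * x p - b l) / w))\<^sup>2
    \<le> 1152 * 504\<^sup>2 * real (card P) * real (card L) * MP * M * (real J + 1) / w"
proof -
  \<comment> \<open>\<open>128 = 4 * 32\<close>: weights up to 2 in absolute value contribute 4, and
    the kernel sum around each line contributes 32.\<close>
  define E where "E = 128 * 504\<^sup>2 * w * real (card L) * M * (real J + 1)"
  have en: "integral (cbox (0,-10) (2,10)) (\<lambda>z. (G j c (fst z) (snd z))\<^sup>2) \<le> E"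
    if j: "2 \<le> j" "j \<le> 4" and c: "\<And>l. l \<in> L \<Longrightarrow> \<bar>c l\<bar> \<le> 2" for j c
  proof -
    have "integral (cbox (0,-10) (2,10)) (\<lambda>z. (G j c (fst z) (snd z))\<^sup>2) =
      integral {0..2} (\<lambda>x. integral {-10..10} (\<lambda>y. (\<Sum>l\<in>L. c l * bump_deriv j ((y - a l * x - b l) / w))\<^sup>2))"
      using integral_prod_continuous[of 0 "-10" 2 10 "\<lambda>z. (G j c (fst z) (snd z))\<^sup>2"]
      by (simp add: G_def[abs_def] continuous_intros continuous_on_G[unfolded G_def])
    also have "\<dots> \<le> (\<Sum>l\<in>L. \<Sum>l'\<in>L. \<bar>c l\<bar> * \<bar>c l'\<bar> * (w * \<bar>line_kernel j w (a l - a l') (b l - b l')\<bar>))"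
      by (rule energy_le[OF w finite_L ab])
    also have "\<dots> \<le> (\<Sum>l\<in>L. \<Sum>l'\<in>L. 2 * 2 * (w * \<bar>line_kernel j w (a l - a l') (b l - b l')\<bar>))"
      using w c by (intro sum_mono mult_right_mono mult_mono) auto
    also have "\<dots> = (\<Sum>l\<in>L. 4 * w * (\<Sum>l'\<in>L. \<bar>line_kernel j w (a l - a l') (b l - b l')\<bar>))"
      by (simp add: sum_distrib_left mult_ac)
    also have "\<dots> \<le> (\<Sum>l\<in>L. 4 * w * (32 * 504\<^sup>2 * M * (real J + 1)))"
      using w ab by (intro sum_mono mult_left_mono sum_abs_line_kernel_le finite_L j cntL J) auto
    also have "\<dots> = E" by (simp add: E_def)
    finally show ?thesis .
  qed
  let ?Big = "cbox (0,-10) (2,10) :: (real \<times> real) set"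
  have Hint: "H integrable_on cbox u v" for u v by (rule integrable_continuous[OF H_cont])
  define Q where "Q p = cbox (x p, y p) (x p + w, y p + w)" for p
  have HQ: "H integrable_on Q p" for p unfolding Q_def by (rule Hint)
  have "integral ?Big H = 4 * integral ?Big (\<lambda>z. (G 2 (\<lambda>_. 1) (fst z) (snd z))\<^sup>2) + 2 * integral ?Big (\<lambda>z. (G 3 (\<lambda>_. 1) (fst z) (snd z))\<^sup>2)
     + 2 * integral ?Big (\<lambda>z. (G 3 a (fst z) (snd z))\<^sup>2) + integral ?Big (\<lambda>z. (G 4 a (fst z) (snd z))\<^sup>2)"
    unfolding H_def
    by (intro integral_unique has_integral_add has_integral_mult_right integrable_integral integrable_continuous
        continuous_intros continuous_on_G)
  also have "\<dots> \<le> 4 * E + 2 * E + 2 * E + E"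
    using ab by (intro add_mono mult_left_mono en) auto
  finally have HE: "integral ?Big H \<le> 9 * E" by simp
  have MP0: "0 \<le> MP" using cntP[of 0 0] of_nat_0_le_iff order_trans by blast
  have sub: "Q p \<subseteq> ?Big" if "p \<in> P" for p
    using xy[OF that] w by (auto simp: Q_def cbox_Pair_eq)
  have "(\<Sum>p\<in>P. integral (Q p) H) \<le> MP * integral ?Big H"
  proof (rule has_integral_le)
    show "((\<lambda>z. \<Sum>p\<in>P. if z \<in> Q p then H z else 0) has_integral (\<Sum>p\<in>P. integral (Q p) H)) ?Big"
    proof (intro has_integral_sum P)
      fix p assume "p \<in> P"
      show "((\<lambda>z. if z \<in> Q p then H z else 0) has_integral integral (Q p) H) ?Big"
        using iffD2[OF has_integral_restrict[OF sub[OF \<open>p \<in> P\<close>]] integrable_integral[OF HQ]] .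
    qed
    show "((\<lambda>z. MP * H z) has_integral MP * integral ?Big H) ?Big"
      by (intro has_integral_mult_right integrable_integral Hint)
    fix z :: "real \<times> real"
    have "(\<Sum>p\<in>P. if z \<in> Q p then H z else 0) = real (card {p\<in>P. z \<in> Q p}) * H z"
      using P by (simp add: sum.If_cases Int_def)
    \<comment> \<open>\<open>z\<close> lies in the square with lower left corner \<open>p\<close>
      exactly when \<open>p\<close> lies in the square with upper right corner \<open>z\<close>, so
      \<open>MP\<close> bounds the overlap.\<close>
    also have "{p\<in>P. z \<in> Q p} = {p \<in> P. fst z - w \<le> x p \<and> x p \<le> fst z - w + w \<and> snd z - w \<le> y p \<and> y p \<le> snd z - w + w}"
      by (cases z) (auto simp: Q_def cbox_Pair_eq)
    also have "real (card \<dots>) * H z \<le> MP * H z"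
      by (rule mult_right_mono[OF cntP H_nonneg])
    finally show "(\<Sum>p\<in>P. if z \<in> Q p then H z else 0) \<le> MP * H z" .
  qed
  also have "\<dots> \<le> MP * (9 * E)" by (rule mult_left_mono[OF HE MP0])
  finally have PE: "(\<Sum>p\<in>P. integral (Q p) H) \<le> MP * (9 * E)" .
  have "(\<Sum>p\<in>P. \<Sum>l\<in>L. bump_deriv 2 ((y p - a l * x p - b l) / w))\<^sup>2 = (\<Sum>p\<in>P. G 2 (\<lambda>_. 1) (x p) (y p))\<^sup>2"
    by (simp add: G_def)
  also have "\<dots> \<le> real (card P) * (\<Sum>p\<in>P. (G 2 (\<lambda>_. 1) (x p) (y p))\<^sup>2)"
    by (rule sum_square_le[OF P])
  also have "\<dots> \<le> real (card P) * (\<Sum>p\<in>P. integral (Q p) H / w\<^sup>2)"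
    unfolding Q_def by (intro mult_left_mono sum_mono G_square_le) simp
  also have "\<dots> = real (card P) / w\<^sup>2 * (\<Sum>p\<in>P. integral (Q p) H)"
    by (simp flip: sum_divide_distrib)
  also have "\<dots> \<le> real (card P) / w\<^sup>2 * (MP * (9 * E))"
    by (rule mult_left_mono[OF PE]) simp
  also have "\<dots> = 1152 * 504\<^sup>2 * real (card P) * real (card L) * MP * M * (real J + 1) / w"
    using w by (simp add: E_def power2_eq_square field_simps)
  finally show ?thesis .
qed

end

section \<open>Incidences at varying scales\<close>

text \<open>A smooth count of incidences at scale \<open>w\<close>. Division by \<open>w\<close>
  makes counts at different scales comparable, since the area of a strip is proportional to its
  width.\<close>

definition weighted_incidences ::
  "'p set \<Rightarrow> ('p \<Rightarrow> real) \<Rightarrow> ('p \<Rightarrow> real) \<Rightarrow> 'l set \<Rightarrow> ('l \<Rightarrow> real) \<Rightarrow> ('l \<Rightarrow> real) \<Rightarrow> real \<Rightarrow> real" where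
  "weighted_incidences P x y L a b w = (\<Sum>p\<in>P. \<Sum>l\<in>L. bump ((y p - a l * x p - b l) / w) ^ 4 / w)"

text \<open>For \<open>f = bump ^ 4\<close> the derivative of \<open>f (d / w) / w\<close> in
  \<open>w\<close> is minus the derivative of \<open>t * f t\<close>, taken at
  \<open>t = d / w\<close>, divided by \<open>w\<^sup>2\<close>. Since \<open>t * bump t ^ 4\<close>
  is \<open>bump_deriv 1 t\<close>, this is the second derivative of a compactly supported function,
  the source of all cancellation.\<close>

lemma has_field_derivative_weighted_incidences:
  assumes w: "0 < w"
  shows "(weighted_incidences P x y L a b has_field_derivative
    - (\<Sum>p\<in>P. \<Sum>l\<in>L. bump_deriv 2 ((y p - a l * x p - b l) / w)) / w\<^sup>2) (at w)"
proof -
  have "((\<lambda>w. bump (d / w) ^ 4 / w) has_field_derivative - (bump_deriv 2 (d / w) / w\<^sup>2)) (at w)" for d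
  proof -
    have 1: "((\<lambda>w. d / w) has_field_derivative - d / w\<^sup>2) (at w)"
      using w by (auto intro!: derivative_eq_intros simp: power2_eq_square)
    have "((\<lambda>w. bump (d / w) ^ 4) has_field_derivative - (8 * (d / w) * bump (d / w) ^ 3 * (- d / w\<^sup>2))) (at w)"
      using has_field_derivative_bump_power[OF 1, of 2] by (simp add: eval_nat_numeral)
    from DERIV_divide[OF this DERIV_ident] show ?thesis
      by (rule DERIV_cong) (use w in \<open>simp_all add: numeral_2_eq_2 field_simps power2_eq_square\<close>)
  qed
  then have "((\<lambda>w. \<Sum>p\<in>P. \<Sum>l\<in>L. bump ((y p - a l * x p - b l) / w) ^ 4 / w) has_field_derivative
     (\<Sum>p\<in>P. \<Sum>l\<in>L. - (bump_deriv 2 ((y p - a l * x p - b l) / w) / w\<^sup>2))) (at w)"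
    by (intro DERIV_sum)
  then show ?thesis
    unfolding weighted_incidences_def[abs_def] by (simp add: sum_negf sum_divide_distrib)
qed

text \<open>The bound on the sum says that the count has derivative at most \<open>E / w\<close>, so
  \<open>E * ln w\<close> minus the count is nondecreasing. Passing through all scales costs only a
  logarithm.\<close>

lemma weighted_incidences_le:
  assumes w: "0 < w1" "w1 \<le> w0" and E: "0 \<le> E"
    and S: "\<And>w. w1 \<le> w \<Longrightarrow> w \<le> w0 \<Longrightarrow> (\<Sum>p\<in>P. \<Sum>l\<in>L. bump_deriv 2 ((y p - a l * x p - b l) / w))\<^sup>2 \<le> (E * w)\<^sup>2"
  shows "weighted_incidences P x y L a b w0 \<le> weighted_incidences P x y L a b w1 + E * ln (w0 / w1)"
proof -
  let ?\<beta> = "weighted_incidences P x y L a b"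
  have "E * ln w1 - ?\<beta> w1 \<le> E * ln w0 - ?\<beta> w0"
  proof (rule DERIV_nonneg_imp_nondecreasing[OF w(2)])
    fix w assume wb: "w1 \<le> w" "w \<le> w0"
    then have w0: "0 < w" using w by simp
    let ?S = "\<Sum>p\<in>P. \<Sum>l\<in>L. bump_deriv 2 ((y p - a l * x p - b l) / w)"
    have "\<bar>?S\<bar> \<le> \<bar>E * w\<bar>" using S[OF wb] by (simp add: abs_le_square_iff)
    then have "- ?S \<le> E * w" using E w0 by (simp add: abs_le_iff)
    then have "0 \<le> (E * w + ?S) / w\<^sup>2" by simp
    also have "\<dots> = E * (1 / w) - (- ?S / w\<^sup>2)" using w0 by (simp add: field_simps power2_eq_square)
    finally have "0 \<le> E * (1 / w) - (- ?S / w\<^sup>2)" .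
    moreover have "((\<lambda>w. E * ln w - ?\<beta> w) has_field_derivative E * (1 / w) - (- ?S / w\<^sup>2)) (at w)"
      using w0 by (intro DERIV_diff DERIV_cmult has_field_derivative_weighted_incidences DERIV_ln_divide)
    ultimately show "\<exists>y. ((\<lambda>w. E * ln w - ?\<beta> w) has_field_derivative y) (at w) \<and> 0 \<le> y" by blast
  qed
  moreover have "ln (w0 / w1) = ln w0 - ln w1" using w by (simp add: ln_div)
  ultimately show ?thesis by (simp add: right_diff_distrib)
qed

section \<open>Elementary counting\<close>

lemma card_le_fibers:
  fixes f :: "'a \<Rightarrow> 'b" and B :: real
  assumes "finite S" "finite Z" "f ` S \<subseteq> Z" and B: "\<And>z. z \<in> Z \<Longrightarrow> real (card {p \<in> S. f p = z}) \<le> B"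
  shows "real (card S) \<le> real (card Z) * B"
proof -
  have "S = (\<Union>z\<in>Z. {p \<in> S. f p = z})" using assms(3) by auto
  then have "card S \<le> (\<Sum>z\<in>Z. card {p \<in> S. f p = z})"
    using card_UN_le[OF assms(2), of "\<lambda>z. {p \<in> S. f p = z}"] by simp
  then have "real (card S) \<le> (\<Sum>z\<in>Z. real (card {p \<in> S. f p = z}))"
    by (metis of_nat_le_iff of_nat_sum)
  also have "\<dots> \<le> (\<Sum>z\<in>Z. B)" by (intro sum_mono B)
  finally show ?thesis by simp
qed

lemma card_int_interval_le:
  fixes S :: "int set" and u v :: real
  assumes "\<And>k. k \<in> S \<Longrightarrow> u \<le> real_of_int k \<and> real_of_int k \<le> v" and "u \<le> v"
  shows "finite S" "real (card S) \<le> v - u + 1"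
proof -
  have sub: "S \<subseteq> {\<lceil>u\<rceil>..\<lfloor>v\<rfloor>}" using assms(1) by (auto simp: le_floor_iff ceiling_le_iff)
  then show "finite S" using finite_subset by blast
  have "card S \<le> nat (\<lfloor>v\<rfloor> - \<lceil>u\<rceil> + 1)" using card_mono[OF _ sub] by simp
  moreover have "\<lfloor>v\<rfloor> - \<lceil>u\<rceil> + 1 \<ge> 0 \<or> card S = 0" using calculation by auto
  moreover have "real_of_int (\<lfloor>v\<rfloor> - \<lceil>u\<rceil> + 1) \<le> v - u + 1"
    by (simp add: add_mono diff_mono)
  ultimately show "real (card S) \<le> v - u + 1" using assms(2)
    by (smt (verit) of_nat_0 of_nat_le_iff of_nat_nat of_int_of_nat_eq)
qed

section \<open>Homogeneous point sets\<close>

text \<open>Points are abstract and carry coordinate functions, so that the axes can be exchanged by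
  swapping \<open>x\<close> and \<open>y\<close>. The side \<open>h\<close> will be
  \<open>1 / sqrt n\<close>.\<close>

locale homogeneous_points =
  fixes P :: "'p set" and x y :: "'p \<Rightarrow> real" and C h :: real
  assumes finite_P: "finite P"
    and coords: "\<And>p. p \<in> P \<Longrightarrow> 0 \<le> x p \<and> x p \<le> 1 \<and> 0 \<le> y p \<and> y p \<le> 1"
    and h_pos: "0 < h" and C_pos: "0 < C"
    and homog: "\<And>X Y. real (card {p \<in> P. X \<le> x p \<and> x p \<le> X + h \<and> Y \<le> y p \<and> y p \<le> Y + h}) \<le> C"
begin

text \<open>Rounding down in units of \<open>h\<close> covers the square by
  \<open>(k + 1)\<^sup>2\<close> squares of side \<open>h\<close>, with
  \<open>k = \<lfloor>w / h\<rfloor>\<close>.\<close>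

lemma card_square_le:
  assumes w: "0 \<le> w"
  shows "real (card {p \<in> P. X \<le> x p \<and> x p \<le> X + w \<and> Y \<le> y p \<and> y p \<le> Y + w}) \<le> C * (w / h + 1)\<^sup>2"
proof -
  let ?S = "{p \<in> P. X \<le> x p \<and> x p \<le> X + w \<and> Y \<le> y p \<and> y p \<le> Y + w}"
  define k where "k = \<lfloor>w / h\<rfloor>"
  have k0: "0 \<le> k" using w h_pos by (simp add: k_def)
  let ?f = "\<lambda>p. (\<lfloor>(x p - X) / h\<rfloor>, \<lfloor>(y p - Y) / h\<rfloor>)"
  have "real (card ?S) \<le> real (card ({0..k} \<times> {0..k})) * C"
  proof (rule card_le_fibers)
    have "0 \<le> \<lfloor>(t - T) / h\<rfloor> \<and> \<lfloor>(t - T) / h\<rfloor> \<le> k" if "T \<le> t" "t \<le> T + w" for t T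
      using that h_pos unfolding k_def by (auto intro!: floor_mono divide_right_mono)
    then show "?f ` ?S \<subseteq> {0..k} \<times> {0..k}" by auto
    fix z :: "int \<times> int"
    obtain i j where z: "z = (i, j)" by (cases z)
    have "T + i * h \<le> t \<and> t \<le> T + i * h + h" if "\<lfloor>(t - T) / h\<rfloor> = i" for t T and i :: int
    proof -
      have "i \<le> (t - T) / h" "(t - T) / h \<le> i + 1" using that by linarith+
      then show ?thesis using h_pos by (simp add: field_simps)
    qed
    then have "{p \<in> ?S. ?f p = z} \<subseteq> {p \<in> P. X + i * h \<le> x p \<and> x p \<le> X + i * h + h \<and> Y + j * h \<le> y p \<and> y p \<le> Y + j * h + h}"
      unfolding z by blast
    then have "card {p \<in> ?S. ?f p = z} \<le> card {p \<in> P. X + i * h \<le> x p \<and> x p \<le> X + i * h + h \<and> Y + j * h \<le> y p \<and> y p \<le> Y + j * h + h}"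
      by (rule card_mono[rotated]) (simp add: finite_P)
    then show "real (card {p \<in> ?S. ?f p = z}) \<le> C"
      using homog[of "X + i * h" "Y + j * h"] by linarith
  qed (auto simp: finite_P)
  also have "real (card ({0..k} \<times> {0..k})) = (real_of_int k + 1)\<^sup>2"
    using k0 by (simp add: card_cartesian_product power2_eq_square add.commute)
  also have "\<dots> * C \<le> (w / h + 1)\<^sup>2 * C"
    using k0 C_pos unfolding k_def by (intro mult_right_mono power_mono) auto
  finally show ?thesis by (simp add: mult.commute)
qed

text \<open>By the pigeonhole principle some thin strip of slope \<open>\<alpha>\<close> contains more than \<open>2 * C\<close> points,
  too many to fit into a box of width \<open>h\<close>; two of them are then far apart in the strip.\<close>

lemma exists_pair_with_slope:
  assumes Q: "Q \<subseteq> P" and sq: "\<And>p. p \<in> Q \<Longrightarrow> X \<le> x p \<and> x p \<le> X + s \<and> Y \<le> y p \<and> y p \<le> Y + s"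
    and s: "0 < s" and \<alpha>: "\<bar>\<alpha>\<bar> \<le> 1" and T: "0 < T" "3 * s / real T \<le> h" and big: "2 * C * (real T + 1) < real (card Q)"
  shows "\<exists>p\<in>Q. \<exists>q\<in>Q. h \<le> x q - x p \<and> \<bar>(y q - y p) - \<alpha> * (x q - x p)\<bar> \<le> 3 * s / real T"
proof (rule ccontr)
  assume neg: "\<not> ?thesis"
  have finQ: "finite Q" using Q finite_P finite_subset by blast
  define \<eta> where "\<eta> = 3 * s / real T"
  have \<eta>: "0 < \<eta>" "\<eta> \<le> h" using s T by (auto simp: \<eta>_def)
  \<comment> \<open>Height of \<open>p\<close> above a line of slope \<open>\<alpha>\<close>,
    shifted by \<open>s\<close> to make it nonnegative. It ranges over \<open>{0..3 * s}\<close>,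
    which strips of width \<open>\<eta>\<close> indexed by \<open>{0..int T}\<close> cover.\<close>
  define v where "v p = y p - \<alpha> * x p - (Y - \<alpha> * X - s)" for p
  let ?f = "\<lambda>p. \<lfloor>v p / \<eta>\<rfloor>"
  have v: "0 \<le> v p \<and> v p \<le> 3 * s" if "p \<in> Q" for p
  proof -
    have "\<bar>\<alpha> * (x p - X)\<bar> \<le> 1 * s" unfolding abs_mult
      using sq[OF that] \<alpha> by (intro mult_mono) auto
    moreover have "v p = (y p - Y) - \<alpha> * (x p - X) + s" by (simp add: v_def algebra_simps)
    ultimately show ?thesis using sq[OF that] by (simp add: abs_le_iff)
  qed
  have "real (card Q) \<le> real (card {0..int T}) * (2 * C)"
  proof (rule card_le_fibers[OF finQ])
    have "\<lfloor>v p / \<eta>\<rfloor> \<in> {0..int T}" if "p \<in> Q" for p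
    proof -
      have "v p / \<eta> \<le> 3 * s / \<eta>" using v[OF that] \<eta> by (intro divide_right_mono) auto
      also have "\<dots> = real T" using s T by (simp add: \<eta>_def)
      finally have "\<lfloor>v p / \<eta>\<rfloor> \<le> \<lfloor>real T\<rfloor>" by (rule floor_mono)
      then show ?thesis using v[OF that] \<eta> by simp
    qed
    then show "?f ` Q \<subseteq> {0..int T}" by blast
    fix z
    let ?F = "{p \<in> Q. ?f p = z}"
    show "real (card ?F) \<le> 2 * C"
    proof (cases "?F = {}")
      case True
      show ?thesis unfolding True using C_pos by simp
    next
      case False
      have finF: "finite ?F" using finQ by simp
      have dv: "\<bar>v q - v p\<bar> \<le> \<eta>" if "p \<in> ?F" "q \<in> ?F" for p q
      proof -
        have "z \<le> v p / \<eta>" "v p / \<eta> \<le> z + 1" "z \<le> v q / \<eta>" "v q / \<eta> \<le> z + 1"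
          using that by (auto simp: floor_eq_iff) 
        then have "z * \<eta> \<le> v p" "v p \<le> z * \<eta> + \<eta>" "z * \<eta> \<le> v q" "v q \<le> z * \<eta> + \<eta>"
          using \<eta> by (simp_all add: field_simps)
        then show ?thesis by linarith
      qed
      have dvq: "v q - v p = (y q - y p) - \<alpha> * (x q - x p)" for p q by (simp add: v_def algebra_simps)
      have dx: "x q - x p < h" if "p \<in> ?F" "q \<in> ?F" for p q
        using neg dv[OF that] that unfolding dvq \<eta>_def by force
      have dy: "y q - y p \<le> 2 * h" if "p \<in> ?F" "q \<in> ?F" for p q
      proof -
        have "\<bar>x q - x p\<bar> \<le> h" using dx[OF that] dx[OF that(2,1)] by linarith
        then have "\<bar>\<alpha> * (x q - x p)\<bar> \<le> 1 * h" unfolding abs_mult using \<alpha> by (intro mult_mono) auto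
        then show ?thesis using dv[OF that] \<eta> unfolding dvq by linarith
      qed
      \<comment> \<open>Points of one strip that are pairwise close in \<open>x\<close> fit into a
        box of width \<open>h\<close> and height \<open>2 * h\<close>. Its left edge passes through
        the leftmost point and its bottom through the lowest; two stacked squares cover it.\<close>
      obtain p where p: "p \<in> ?F" "\<And>q. q \<in> ?F \<Longrightarrow> x p \<le> x q"
        using arg_min_if_finite[OF finF False, of x] by (meson not_le)
      obtain r where r: "r \<in> ?F" "\<And>q. q \<in> ?F \<Longrightarrow> y r \<le> y q"
        using arg_min_if_finite[OF finF False, of y] by (meson not_le)
      let ?B = "\<lambda>Y. {q \<in> P. x p \<le> x q \<and> x q \<le> x p + h \<and> Y \<le> y q \<and> y q \<le> Y + h}"
      have "?F \<subseteq> ?B (y r) \<union> ?B (y r + h)"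
      proof
        fix q assume q: "q \<in> ?F"
        have "x q - x p < h" "y q - y r \<le> 2 * h" using dx[OF p(1) q] dy[OF r(1) q] by auto
        then show "q \<in> ?B (y r) \<union> ?B (y r + h)"
          using p(2)[OF q] r(2)[OF q] q Q by (cases "y q \<le> y r + h") auto
      qed
      then have "card ?F \<le> card (?B (y r) \<union> ?B (y r + h))"
        by (rule card_mono[rotated]) (simp add: finite_P)
      also have "\<dots> \<le> card (?B (y r)) + card (?B (y r + h))" by (rule card_Un_le)
      finally show ?thesis using homog[of "x p" "y r"] homog[of "x p" "y r + h"] by linarith
    qed
  qed auto
  then show False using big by (simp add: algebra_simps)
qed

end

lemma bump_power4_ge:
  assumes "\<bar>t\<bar> \<le> 1 / 2"
  shows "1 / 4 \<le> bump t ^ 4"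
proof -
  have "t\<^sup>2 \<le> (1 / 2)\<^sup>2" using assms by (simp add: abs_le_square_iff[symmetric])
  then have "3 / 4 \<le> bump t" by (simp add: bump_def power2_eq_square)
  then have "(3 / 4) ^ 4 \<le> bump t ^ 4" by (rule power_mono) simp
  then show ?thesis by (simp add: eval_nat_numeral)
qed

section \<open>The configuration of spanned lines\<close>

text \<open>Cells have side \<open>1 / m\<close> and slopes are multiples of \<open>1 / D\<close>.
  \<open>T\<close> counts strips: \<open>T_upper\<close> permits the pigeonhole argument in a good
  cell, and \<open>T_lower\<close> makes the slopes accurate to \<open>1 / (4 * D)\<close>. The
  determinant is twice the triangle area, so \<open>det_gt\<close> is the absence of small
  triangles; \<open>cone\<close> selects the axis along which at least half of the pairs have slope
  at most 1 in absolute value.\<close>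

locale heilbronn_config = homogeneous_points P x y C "1 / sqrt (real n)"
  for P :: "'p set" and x y :: "'p \<Rightarrow> real" and C :: real and n :: nat +
  fixes w1 :: real and m T D :: nat
  assumes card_P: "card P = n" and n_pos: "0 < n" and m_pos: "0 < m" and T_pos: "0 < T" and D_pos: "0 < D" and w1_pos: "0 < w1"
    and K_ge_1: "real m \<le> sqrt (real n)"
    and T_upper: "2 * C * (real T + 1) < real n / (16 * (real m)\<^sup>2)"
    and T_lower: "12 * sqrt (real n) / real m * real D \<le> real T"
    and cone: "(real n)\<^sup>2 / 2 \<le> real (card {(p, q). p \<in> P \<and> q \<in> P \<and> \<bar>y p - y q\<bar> \<le> \<bar>x p - x q\<bar>})"
    and det_gt: "\<And>p q r. p \<in> P \<Longrightarrow> q \<in> P \<Longrightarrow> r \<in> P \<Longrightarrow> p \<noteq> q \<Longrightarrow> p \<noteq> r \<Longrightarrow> q \<noteq> r \<Longrightarrow>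
       w1 / real m < \<bar>(x q - x p) * (y r - y p) - (y q - y p) * (x r - x p)\<bar>"
begin

definition cell :: "'p \<Rightarrow> int \<times> int" where
  "cell p = (\<lfloor>real m * x p\<rfloor>, \<lfloor>real m * y p\<rfloor>)"

definition Q :: "int \<times> int \<Rightarrow> 'p set" where
  "Q z = {p \<in> P. cell p = z}"

text \<open>The index \<open>m\<close> is included because a coordinate may equal 1.\<close>

definition cells :: "(int \<times> int) set" where
  "cells = {0..int m} \<times> {0..int m}"

text \<open>The threshold is small enough for the bad cells together to hold at most a quarter of
  the points.\<close>

definition good :: "(int \<times> int) set" where
  "good = {z \<in> cells. real n / (16 * (real m)\<^sup>2) \<le> real (card (Q z))}"

text \<open>A line is represented by its cell and its slope index: \<open>(z, i)\<close> stands for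
  a line spanned in cell \<open>z\<close> with slope near \<open>i / D\<close>.\<close>

definition L :: "((int \<times> int) \<times> int) set" where
  "L = good \<times> {- int D..int D}"

lemma finite_L: "finite L" and finite_good: "finite good" and finite_cells: "finite cells"
  by (auto simp: L_def good_def cells_def)

lemma cell_in: "p \<in> P \<Longrightarrow> cell p \<in> cells"
  using coords[of p] m_pos by (auto simp: cell_def cells_def floor_le_iff mult_left_le
    intro!: order.strict_trans1[OF mult_left_le])

lemma card_cells: "real (card cells) \<le> 4 * (real m)\<^sup>2"
proof -
  have "real (card cells) = (real m + 1)\<^sup>2" by (simp add: cells_def card_cartesian_product power2_eq_square)
  also have "\<dots> \<le> (2 * real m)\<^sup>2" using m_pos by (intro power_mono) auto
  finally show ?thesis by (simp add: power_mult_distrib)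
qed

lemma Q_bounds:
  assumes "p \<in> Q z"
  shows "p \<in> P" "real_of_int (fst z) / real m \<le> x p \<and> x p \<le> real_of_int (fst z) / real m + 1 / real m \<and> real_of_int (snd z) / real m \<le> y p \<and> y p \<le> real_of_int (snd z) / real m + 1 / real m"
proof -
  have *: "real_of_int k / real m \<le> t \<and> t \<le> real_of_int k / real m + 1 / real m" if "\<lfloor>real m * t\<rfloor> = k" for k :: int and t
  proof -
    have "k \<le> real m * t" "real m * t \<le> k + 1" using that by linarith+
    then show ?thesis using m_pos by (simp add: field_simps)
  qed
  show "p \<in> P" "real_of_int (fst z) / real m \<le> x p \<and> x p \<le> real_of_int (fst z) / real m + 1 / real m \<and> real_of_int (snd z) / real m \<le> y p \<and> y p \<le> real_of_int (snd z) / real m + 1 / real m"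
    using assms by (auto simp: Q_def cell_def *)
qed

lemma card_Q_le: "real (card (Q z)) \<le> 4 * C * real n / (real m)\<^sup>2"
proof -
  have sub: "Q z \<subseteq> {p \<in> P. real_of_int (fst z) / real m \<le> x p \<and> x p \<le> real_of_int (fst z) / real m + 1 / real m \<and> real_of_int (snd z) / real m \<le> y p \<and> y p \<le> real_of_int (snd z) / real m + 1 / real m}"
    using Q_bounds by blast
  have "card (Q z) \<le> card {p \<in> P. real_of_int (fst z) / real m \<le> x p \<and> x p \<le> real_of_int (fst z) / real m + 1 / real m \<and> real_of_int (snd z) / real m \<le> y p \<and> y p \<le> real_of_int (snd z) / real m + 1 / real m}"
    by (rule card_mono[OF _ sub]) (simp add: finite_P)
  also have "real \<dots> \<le> C * (1 / real m / (1 / sqrt n) + 1)\<^sup>2"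
    by (rule card_square_le) simp
  finally have "real (card (Q z)) \<le> C * (1 / real m / (1 / sqrt n) + 1)\<^sup>2" by simp
  also have "\<dots> \<le> C * (2 * (sqrt n / m))\<^sup>2"
    using C_pos K_ge_1 m_pos by (intro mult_left_mono power_mono) (auto simp: field_simps)
  also have "\<dots> = 4 * C * real n / (real m)\<^sup>2" by (simp add: power_mult_distrib power_divide)
  finally show ?thesis .
qed

definition pair :: "(int \<times> int) \<times> int \<Rightarrow> 'p \<times> 'p" where
  "pair l = (SOME (p, q). p \<in> Q (fst l) \<and> q \<in> Q (fst l) \<and> 1 / sqrt (real n) \<le> x q - x p \<and>
     \<bar>(y q - y p) - real_of_int (snd l) / real D * (x q - x p)\<bar> \<le> (x q - x p) / (4 * real D))"

definition p1 where "p1 l = fst (pair l)"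
definition p2 where "p2 l = snd (pair l)"
definition a where "a l = (y (p2 l) - y (p1 l)) / (x (p2 l) - x (p1 l))"
definition b where "b l = y (p1 l) - a l * x (p1 l)"

text \<open>The pigeonhole lemma, applied to a good cell with \<open>s = 1 / m\<close>, shows that
  the choice in \<open>pair\<close> is not vacuous.\<close>

lemma pair_props:
  assumes l: "l \<in> L"
  shows "p1 l \<in> Q (fst l)" "p2 l \<in> Q (fst l)" "1 / sqrt (real n) \<le> x (p2 l) - x (p1 l)"
    "\<bar>(y (p2 l) - y (p1 l)) - real_of_int (snd l) / real D * (x (p2 l) - x (p1 l))\<bar> \<le> (x (p2 l) - x (p1 l)) / (4 * real D)"
proof -
  let ?z = "fst l" and ?\<alpha> = "real_of_int (snd l) / real D"
  have \<alpha>: "\<bar>?\<alpha>\<bar> \<le> 1" using l D_pos by (auto simp: L_def abs_le_iff field_simps)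
  \<comment> \<open>\<open>T_lower\<close>, rearranged: a strip is so thin that two points at
    horizontal distance at least \<open>1 / sqrt n\<close> in it determine the slope up to
    \<open>1 / (4 * D)\<close>.\<close>
  have *: "3 * ( 1 / real m) / T \<le> 1 / sqrt n / (4 * real D)"
    using T_lower T_pos m_pos D_pos n_pos by (simp add: field_simps)
  also have "\<dots> \<le> 1 / sqrt n / 1" using D_pos n_pos by (intro divide_left_mono) auto
  finally have **: "3 * ( 1 / real m) / T \<le> 1 / sqrt n" by simp
  have "\<exists>p\<in>Q ?z. \<exists>q\<in>Q ?z. 1 / sqrt n \<le> x q - x p \<and> \<bar>(y q - y p) - ?\<alpha> * (x q - x p)\<bar> \<le> 3 * ( 1 / real m) / T"
  proof (rule exists_pair_with_slope)
    show "2 * C * (real T + 1) < real (card (Q ?z))"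
      using T_upper l by (auto simp: L_def good_def)
    show "real_of_int (fst ?z) / real m \<le> x p \<and> x p \<le> real_of_int (fst ?z) / real m + 1 / real m \<and>
        real_of_int (snd ?z) / real m \<le> y p \<and> y p \<le> real_of_int (snd ?z) / real m + 1 / real m" if "p \<in> Q ?z" for p
      by (rule Q_bounds(2)[OF that])
    show "Q ?z \<subseteq> P" by (auto simp: Q_def)
  qed (use m_pos \<alpha> T_pos ** in auto)
  then obtain p q where pq: "p \<in> Q ?z" "q \<in> Q ?z" "1 / sqrt n \<le> x q - x p"
      "\<bar>(y q - y p) - ?\<alpha> * (x q - x p)\<bar> \<le> 3 * ( 1 / real m) / T" by blast
  note pq(4) also note * also have "1 / sqrt n / (4 * real D) \<le> (x q - x p) / (4 * real D)"
    using pq(3) by (intro divide_right_mono) auto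
  finally have "\<exists>w. case w of (p, q) \<Rightarrow> p \<in> Q ?z \<and> q \<in> Q ?z \<and> 1 / sqrt (real n) \<le> x q - x p \<and>
     \<bar>(y q - y p) - ?\<alpha> * (x q - x p)\<bar> \<le> (x q - x p) / (4 * real D)"
    using pq by blast
  from someI_ex[OF this] 
  show "p1 l \<in> Q (fst l)" "p2 l \<in> Q (fst l)" "1 / sqrt (real n) \<le> x (p2 l) - x (p1 l)"
    "\<bar>(y (p2 l) - y (p1 l)) - real_of_int (snd l) / real D * (x (p2 l) - x (p1 l))\<bar> \<le> (x (p2 l) - x (p1 l)) / (4 * real D)"
    unfolding p1_def p2_def pair_def by (auto simp: case_prod_unfold)
qed

lemma pair_dx:
  assumes l: "l \<in> L"
  shows "0 < x (p2 l) - x (p1 l)" "x (p2 l) - x (p1 l) \<le> 1 / real m" "p1 l \<in> P" "p2 l \<in> P" "p1 l \<noteq> p2 l"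
proof -
  show *: "0 < x (p2 l) - x (p1 l)" using pair_props(3)[OF l] n_pos
    by (smt (verit) divide_pos_pos of_nat_0_less_iff real_sqrt_gt_zero)
  show "x (p2 l) - x (p1 l) \<le> 1 / real m"
    using Q_bounds(2)[OF pair_props(1)[OF l]] Q_bounds(2)[OF pair_props(2)[OF l]] by linarith
  show "p1 l \<in> P" "p2 l \<in> P" using pair_props[OF l] Q_bounds by blast+
  show "p1 l \<noteq> p2 l" using * by auto
qed

lemma line_eqs:
  assumes l: "l \<in> L"
  shows "y (p1 l) - a l * x (p1 l) - b l = 0" "y (p2 l) - a l * x (p2 l) - b l = 0"
  using pair_dx(1)[OF l] by (auto simp: a_def b_def field_simps)

lemma slope:
  assumes l: "l \<in> L"
  shows "\<bar>a l - real_of_int (snd l) / real D\<bar> \<le> 1 / (4 * real D)"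
proof -
  let ?d = "x (p2 l) - x (p1 l)"
  have d: "0 < ?d" by (rule pair_dx[OF l])
  have "a l * ?d = y (p2 l) - y (p1 l)" using d by (simp add: a_def)
  then have "(a l - real_of_int (snd l) / real D) * ?d = (y (p2 l) - y (p1 l)) - real_of_int (snd l) / real D * ?d"
    by (simp only: left_diff_distrib)
  then have "\<bar>a l - real_of_int (snd l) / real D\<bar> * \<bar>?d\<bar> \<le> ?d / (4 * real D)"
    using pair_props(4)[OF l] by (simp only: abs_mult[symmetric])
  then have "\<bar>a l - real_of_int (snd l) / real D\<bar> * ?d \<le> 1 / (4 * real D) * ?d"
    using d by simp
  then show ?thesis using d by (rule mult_right_le_imp_le)
qed

lemma ab_bounds:
  assumes l: "l \<in> L"
  shows "\<bar>a l\<bar> \<le> 2 \<and> \<bar>b l\<bar> \<le> 3"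
proof -
  have "\<bar>real_of_int (snd l) / real D\<bar> \<le> 1" using l D_pos by (auto simp: L_def abs_le_iff field_simps)
  moreover have "1 / (4 * real D) \<le> 1" using D_pos by simp
  ultimately have a: "\<bar>a l\<bar> \<le> 2" using slope[OF l] by linarith
  have c: "0 \<le> x (p1 l) \<and> x (p1 l) \<le> 1 \<and> 0 \<le> y (p1 l) \<and> y (p1 l) \<le> 1"
    using coords pair_dx(3)[OF l] by blast
  then have "\<bar>a l * x (p1 l)\<bar> \<le> 2 * 1" unfolding abs_mult using a by (intro mult_mono) auto
  then show ?thesis using a c unfolding b_def by linarith
qed

section \<open>Separation and counting of the lines\<close>

text \<open>The determinant of \<open>p1 l\<close>, \<open>p2 l\<close>, \<open>r\<close> is the
  horizontal distance of the spanning pair times the vertical distance of \<open>r\<close> from the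
  line. The former is at most \<open>1 / m\<close>.\<close>

lemma far:
  assumes l: "l \<in> L" and r: "r \<in> P" "r \<noteq> p1 l" "r \<noteq> p2 l"
  shows "w1 < \<bar>y r - a l * x r - b l\<bar>"
proof -
  let ?d = "x (p2 l) - x (p1 l)"
  have d: "0 < ?d" "?d \<le> 1 / real m" by (rule pair_dx[OF l])+
  have "a l * ?d = y (p2 l) - y (p1 l)" using d by (simp add: a_def)
  then have "?d * (y r - y (p1 l)) - (y (p2 l) - y (p1 l)) * (x r - x (p1 l)) = ?d * (y r - a l * x r - b l)"
    unfolding b_def by algebra
  then have "w1 / real m < \<bar>?d * (y r - a l * x r - b l)\<bar>"
    using det_gt[of "p1 l" "p2 l" r] pair_dx[OF l] r by metis
  also have "\<dots> = ?d * \<bar>y r - a l * x r - b l\<bar>" using d by (simp add: abs_mult)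
  also have "\<dots> \<le> 1 / real m * \<bar>y r - a l * x r - b l\<bar>" using d by (intro mult_right_mono) auto
  finally show ?thesis using m_pos by (simp add: divide_less_cancel)
qed

lemma dist_le:
  assumes "l \<in> L" "l' \<in> L" "\<bar>a l' - a l\<bar> \<le> r" "\<bar>b l' - b l\<bar> \<le> r'" "p \<in> P" "y p - a l' * x p - b l' = 0"
  shows "\<bar>y p - a l * x p - b l\<bar> \<le> r + r'"
proof -
  have "y p - a l * x p - b l = (a l' - a l) * x p + (b l' - b l)" using assms(6) unfolding left_diff_distrib by linarith
  moreover have "\<bar>(a l' - a l) * x p\<bar> \<le> r * 1" unfolding abs_mult
    using assms coords[of p] by (intro mult_mono) auto
  ultimately show ?thesis using assms(4) by linarith
qed

text \<open>If the coefficients are close, both spanning points of \<open>l'\<close> lie within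
  \<open>w1 / 2\<close> of \<open>l\<close>, so by \<open>far\<close> they are the spanning points
  of \<open>l\<close>, in the same order of \<open>x\<close>. The cells then agree, and equal slopes
  put the slope indices within \<open>1 / 2\<close> of each other.\<close>

lemma close_lines_eq:
  assumes l: "l \<in> L" "l' \<in> L" and "\<bar>a l' - a l\<bar> \<le> w1 / 4" "\<bar>b l' - b l\<bar> \<le> w1 / 4"
  shows "l = l'"
proof -
  have "\<bar>y p - a l * x p - b l\<bar> \<le> w1 / 4 + w1 / 4" if "p = p1 l' \<or> p = p2 l'" for p
    using that pair_dx[OF l(2)] line_eqs[OF l(2)] by (intro dist_le[OF l assms(3,4)]) auto
  then have "\<not> w1 < \<bar>y p - a l * x p - b l\<bar>" if "p = p1 l' \<or> p = p2 l'" for p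
    using that w1_pos by fastforce
  then have "p1 l' \<in> {p1 l, p2 l}" "p2 l' \<in> {p1 l, p2 l}"
    using far[OF l(1)] pair_dx[OF l(2)] by blast+
  then have eq: "p1 l' = p1 l" "p2 l' = p2 l"
    using pair_dx(1)[OF l(1)] pair_dx(1)[OF l(2)] by auto
  have "fst l' = fst l"
    using pair_props(1)[OF l(1)] pair_props(1)[OF l(2)] eq by (simp add: Q_def)
  moreover have "snd l' = snd l"
  proof -
    have "a l' = a l" by (simp add: a_def eq)
    then have "\<bar>real_of_int (snd l') / real D - real_of_int (snd l) / real D\<bar> \<le> 1 / (4 * real D) + 1 / (4 * real D)"
      using slope[OF l(1)] slope[OF l(2)] by linarith
    then have "\<bar>real_of_int (snd l' - snd l)\<bar> < 1"
      using D_pos by (simp add: field_simps flip: diff_divide_distrib)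
    then show ?thesis by linarith
  qed
  ultimately show ?thesis by (simp add: prod_eq_iff)
qed

text \<open>Rounding both coefficients to a grid of mesh \<open>w1 / 4\<close> is injective by
  \<open>close_lines_eq\<close>, so it suffices to count grid points. For small scales.\<close>

lemma count_lines_fine:
  assumes l: "l \<in> L" and r: "w1 \<le> r"
  shows "real (card {l' \<in> L. \<bar>a l' - a l\<bar> \<le> r \<and> \<bar>b l' - b l\<bar> \<le> 5 * r}) \<le> 420 * (r / w1)\<^sup>2"
proof -
  let ?S = "{l' \<in> L. \<bar>a l' - a l\<bar> \<le> r \<and> \<bar>b l' - b l\<bar> \<le> 5 * r}"
  define A where "A t = \<lfloor>4 * t / w1\<rfloor>" for t
  define R where "R = r / w1"
  have R: "1 \<le> R" using r w1_pos by (simp add: R_def)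
  have close: "\<bar>t - u\<bar> \<le> w1 / 4" if "A t = A u" for t u
  proof -
    have "\<bar>4 * t / w1 - 4 * u / w1\<bar> \<le> 1" using that unfolding A_def by linarith
    then have "t * 4 \<le> w1 + u * 4 \<and> u * 4 \<le> w1 + t * 4" using w1_pos by (simp add: abs_le_iff field_simps)
    then show ?thesis by linarith
  qed
  have inj: "inj_on (\<lambda>l. (A (a l), A (b l))) ?S"
  proof (rule inj_onI)
    fix l l' assume "l \<in> ?S" "l' \<in> ?S" "(A (a l), A (b l)) = (A (a l'), A (b l'))"
    then show "l = l'" using close_lines_eq[of l l'] close[of "a l'" "a l"] close[of "b l'" "b l"] by auto
  qed
  have range: "4 * t / w1 - 4 * k * R - 1 \<le> A u \<and> A u \<le> 4 * t / w1 + 4 * k * R" if "\<bar>u - t\<bar> \<le> k * r" for t u k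
  proof -
    have "4 * u / w1 - 4 * t / w1 = 4 / w1 * (u - t)" using w1_pos by (simp add: field_simps)
    then have "\<bar>4 * u / w1 - 4 * t / w1\<bar> = 4 / w1 * \<bar>u - t\<bar>" using w1_pos by (simp only: abs_mult) simp
    also have "\<dots> \<le> 4 / w1 * (k * r)" using that w1_pos by (intro mult_left_mono) auto
    also have "\<dots> = 4 * k * R" by (simp add: R_def)
    finally show ?thesis unfolding A_def by linarith
  qed
  define S where "S t k = {i. 4 * t / w1 - 4 * k * R - 1 \<le> real_of_int i \<and> real_of_int i \<le> 4 * t / w1 + 4 * k * R}" for t k
  have S: "finite (S t k)" "real (card (S t k)) \<le> 8 * k * R + 2" if "0 \<le> k" for t k
  proof -
    have kR: "0 \<le> k * R" using that R by simp
    then have le: "4 * t / w1 - 4 * k * R - 1 \<le> 4 * t / w1 + 4 * k * R" unfolding mult.assoc by linarith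
    have mem: "4 * t / w1 - 4 * k * R - 1 \<le> real_of_int i \<and> real_of_int i \<le> 4 * t / w1 + 4 * k * R" if "i \<in> S t k" for i
      using that unfolding S_def by blast
    show "finite (S t k)" by (rule card_int_interval_le(1)[OF mem le])
    show "real (card (S t k)) \<le> 8 * k * R + 2"
      using card_int_interval_le(2)[of "S t k", OF mem le] unfolding mult.assoc by linarith
  qed
  have "(\<lambda>l. (A (a l), A (b l))) ` ?S \<subseteq> S (a l) 1 \<times> S (b l) 5"
  proof (rule image_subsetI)
    fix l' assume "l' \<in> ?S"
    then have "\<bar>a l' - a l\<bar> \<le> 1 * r" "\<bar>b l' - b l\<bar> \<le> 5 * r" by auto
    from range[OF this(1)] range[OF this(2)] show "(A (a l'), A (b l')) \<in> S (a l) 1 \<times> S (b l) 5"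
      by (simp add: S_def)
  qed
  then have "card ?S \<le> card (S (a l) 1 \<times> S (b l) 5)"
    by (rule card_inj_on_le[OF inj]) (simp add: S)
  then have "real (card ?S) \<le> real (card (S (a l) 1)) * real (card (S (b l) 5))"
    unfolding card_cartesian_product by (simp only: of_nat_mult[symmetric] of_nat_le_iff)
  also have "\<dots> \<le> (8 * R + 2) * (40 * R + 2)"
    using R S(2)[of 1 "a l"] S(2)[of 5 "b l"] by (intro mult_mono) auto
  also have "\<dots> \<le> (10 * R) * (42 * R)" using R by (intro mult_mono) auto
  finally show ?thesis by (simp add: R_def power2_eq_square)
qed

text \<open>For scales of at least a cell: a line close to \<open>l\<close> comes from a cell near
  \<open>l\<close>, with about \<open>r * m\<close> choices in each column of cells, and has about
  \<open>1 + r * D\<close> choices of slope index.\<close>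

lemma count_lines_coarse:
  assumes l: "l \<in> L" and r: "1 / real m \<le> r"
  shows "real (card {l' \<in> L. \<bar>a l' - a l\<bar> \<le> r \<and> \<bar>b l' - b l\<bar> \<le> 5 * r}) \<le> 76 * r * (real m)\<^sup>2 * (1 + r * real D)"
proof -
  let ?S = "{l' \<in> L. \<bar>a l' - a l\<bar> \<le> r \<and> \<bar>b l' - b l\<bar> \<le> 5 * r}"
  have r0: "0 < r" using r m_pos by (smt (verit) divide_pos_pos of_nat_0_less_iff)
  have rm: "1 \<le> r * real m" using r m_pos by (simp add: field_simps)
  \<comment> \<open>The height of \<open>l\<close> at the left edge of column \<open>j\<close>, in
    units of the cell side.\<close>
  define c where "c j = a l * real_of_int j + b l * real m" for j
  define A where "A j = {k. c j - 9 * (r * real m) \<le> real_of_int k \<and> real_of_int k \<le> c j + 9 * (r * real m)}" for j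
  define B where "B = {i. a l * real D - (r * real D + 1 / 4) \<le> real_of_int i \<and> real_of_int i \<le> a l * real D + (r * real D + 1 / 4)}"
  have A: "finite (A j)" "real (card (A j)) \<le> 19 * (r * real m)" for j
  proof -
    have mem: "c j - 9 * (r * real m) \<le> real_of_int k \<and> real_of_int k \<le> c j + 9 * (r * real m)" if "k \<in> A j" for k
      using that unfolding A_def by blast
    have le: "c j - 9 * (r * real m) \<le> c j + 9 * (r * real m)" using rm by linarith
    show "finite (A j)" by (rule card_int_interval_le(1)[OF mem le])
    show "real (card (A j)) \<le> 19 * (r * real m)"
      using card_int_interval_le(2)[of "A j", OF mem le] rm by linarith
  qed
  have rD: "0 \<le> r * real D" using r0 by simp
  have B: "finite B" "real (card B) \<le> 2 * (1 + r * real D)"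
  proof -
    have mem: "a l * real D - (r * real D + 1 / 4) \<le> real_of_int i \<and> real_of_int i \<le> a l * real D + (r * real D + 1 / 4)" if "i \<in> B" for i
      using that unfolding B_def by blast
    have le: "a l * real D - (r * real D + 1 / 4) \<le> a l * real D + (r * real D + 1 / 4)" using rD by linarith
    show "finite B" by (rule card_int_interval_le(1)[OF mem le])
    have "real (card B) \<le> a l * real D + (r * real D + 1 / 4) - (a l * real D - (r * real D + 1 / 4)) + 1"
      by (rule card_int_interval_le(2)[OF mem le])
    then show "real (card B) \<le> 2 * (1 + r * real D)" by (simp add: algebra_simps)
  qed
  have "?S \<subseteq> (SIGMA j:{0..int m}. A j) \<times> B"
  proof
    fix l' assume "l' \<in> ?S"
    then have l': "l' \<in> L" "\<bar>a l' - a l\<bar> \<le> r" "\<bar>b l' - b l\<bar> \<le> 5 * r" by auto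
    obtain j k i where e: "l' = ((j, k), i)" by (metis prod.collapse)
    let ?p = "p1 l'"
    have j: "j \<in> {0..int m}" using l'(1) by (simp add: e L_def good_def cells_def)
    have p: "?p \<in> P" by (rule pair_dx[OF l'(1)])
    have q: "real_of_int j / real m \<le> x ?p" "x ?p \<le> real_of_int j / real m + 1 / real m"
      "real_of_int k / real m \<le> y ?p" "y ?p \<le> real_of_int k / real m + 1 / real m"
      using Q_bounds(2)[OF pair_props(1)[OF l'(1)]] by (simp_all add: e)
    have d: "\<bar>y ?p - a l * x ?p - b l\<bar> \<le> r + 5 * r"
      using line_eqs(1)[OF l'(1)] by (intro dist_le[OF l l' p])
    have "\<bar>a l * (x ?p - real_of_int j / real m)\<bar> \<le> 2 * (1 / real m)"
      unfolding abs_mult using ab_bounds[OF l] q by (intro mult_mono) auto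
    \<comment> \<open>\<open>6 * r\<close> for the point, \<open>2 / m\<close> for the slope across
      the cell and \<open>1 / m\<close> for its height; \<open>1 / m \<le> r\<close>.\<close>
    then have "\<bar>real_of_int k / real m - a l * (real_of_int j / real m) - b l\<bar> \<le> 9 * r"
      using d q r unfolding right_diff_distrib by linarith
    then have "\<bar>real_of_int k / real m - a l * (real_of_int j / real m) - b l\<bar> * real m \<le> 9 * r * real m"
      by (rule mult_right_mono) simp
    moreover have "\<bar>real_of_int k / real m - a l * (real_of_int j / real m) - b l\<bar> * real m = \<bar>real_of_int k - c j\<bar>"
    proof -
      have "(real_of_int k / real m - a l * (real_of_int j / real m) - b l) * real m = real_of_int k - c j"
        using m_pos by (simp add: c_def field_simps)
      then show ?thesis by (metis abs_mult abs_of_nat)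
    qed
    ultimately have "k \<in> A j" unfolding A_def by (simp add: abs_le_iff)
    moreover have "i \<in> B"
    proof -
      have "\<bar>a l - real_of_int i / real D\<bar> \<le> r + 1 / (4 * real D)"
        using slope[OF l'(1)] l'(2) by (simp add: e)
      then have "\<bar>a l - real_of_int i / real D\<bar> * real D \<le> (r + 1 / (4 * real D)) * real D"
        by (rule mult_right_mono) simp
      moreover have "\<bar>a l - real_of_int i / real D\<bar> * real D = \<bar>a l * real D - real_of_int i\<bar>"
      proof -
        have "(a l - real_of_int i / real D) * real D = a l * real D - real_of_int i"
          using D_pos by (simp add: field_simps)
        then show ?thesis by (metis abs_mult abs_of_nat)
      qed
      moreover have "(r + 1 / (4 * real D)) * real D = r * real D + 1 / 4" using D_pos by (simp add: field_simps)
      ultimately have "\<bar>a l * real D - real_of_int i\<bar> \<le> r * real D + 1 / 4" by linarith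
      then show ?thesis unfolding B_def mem_Collect_eq by linarith
    qed
    ultimately show "l' \<in> (SIGMA j:{0..int m}. A j) \<times> B" using j by (simp add: e)
  qed
  then have "card ?S \<le> card ((SIGMA j:{0..int m}. A j) \<times> B)"
    by (rule card_mono[rotated]) (simp add: A B)
  also have "\<dots> = (\<Sum>j\<in>{0..int m}. card (A j)) * card B"
    by (simp add: card_cartesian_product A)
  finally have "card ?S \<le> (\<Sum>j\<in>{0..int m}. card (A j)) * card B" .
  then have "real (card ?S) \<le> (\<Sum>j\<in>{0..int m}. real (card (A j))) * real (card B)"
    by (simp only: of_nat_mult[symmetric] of_nat_sum[symmetric] of_nat_le_iff)
  also have "\<dots> \<le> (\<Sum>j\<in>{0..int m}. 19 * (r * real m)) * (2 * (1 + r * real D))"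
    using r0 by (intro mult_mono sum_mono A B sum_nonneg) auto
  also have "\<dots> = (real m + 1) * (19 * (r * real m)) * (2 * (1 + r * real D))" by simp
  also have "\<dots> \<le> (2 * real m) * (19 * (r * real m)) * (2 * (1 + r * real D))"
    using m_pos r0 by (intro mult_right_mono) auto
  finally show ?thesis by (simp add: power2_eq_square mult_ac)
qed

lemma card_L_le: "real (card L) \<le> 12 * (real m)\<^sup>2 * real D"
proof -
  have "card good \<le> card cells" by (rule card_mono) (auto simp: finite_cells good_def)
  then have "real (card good) \<le> 4 * (real m)\<^sup>2" using card_cells by linarith
  moreover have "real (card {- int D..int D}) \<le> 3 * real D" using D_pos by simp
  ultimately have "real (card good) * real (card {- int D..int D}) \<le> (4 * (real m)\<^sup>2) * (3 * real D)"
    by (intro mult_mono) auto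
  then show ?thesis by (simp add: L_def card_cartesian_product)
qed

text \<open>At most \<open>4 * m\<^sup>2\<close> bad cells, each with fewer than
  \<open>n / (16 * m\<^sup>2)\<close> points.\<close>

lemma card_bad_le: "real (card {q \<in> P. cell q \<notin> good}) \<le> real n / 4"
proof -
  have "real (card {q \<in> P. cell q \<notin> good}) \<le> real (card (cells - good)) * (real n / (16 * (real m)\<^sup>2))"
  proof (rule card_le_fibers)
    show "cell ` {q \<in> P. cell q \<notin> good} \<subseteq> cells - good" using cell_in by auto
    fix z assume z: "z \<in> cells - good"
    have "card {p \<in> {q \<in> P. cell q \<notin> good}. cell p = z} \<le> card (Q z)"
      by (rule card_mono) (auto simp: Q_def finite_P)
    moreover have "real (card (Q z)) \<le> real n / (16 * (real m)\<^sup>2)" using z by (auto simp: good_def)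
    ultimately show "real (card {p \<in> {q \<in> P. cell q \<notin> good}. cell p = z}) \<le> real n / (16 * (real m)\<^sup>2)" by linarith
  qed (auto simp: finite_P finite_cells)
  also have "\<dots> \<le> (4 * (real m)\<^sup>2) * (real n / (16 * (real m)\<^sup>2))"
  proof (rule mult_right_mono)
    have "card (cells - good) \<le> card cells" by (rule card_mono) (auto simp: finite_cells)
    then show "real (card (cells - good)) \<le> 4 * (real m)\<^sup>2" using card_cells by linarith
  qed simp
  also have "\<dots> = real n / 4" using m_pos by simp
  finally show ?thesis .
qed

section \<open>Incidences at the coarse and the fine scale\<close>

text \<open>Take the slope index just below the slope from \<open>q\<close> to \<open>p\<close>. The
  chosen line starts in the cell of \<open>q\<close>, so its vertical distance from \<open>p\<close>
  is at most \<open>1 / m + 5 / (4 * D) + 2 / m\<close>, which is below \<open>5 / D\<close> as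
  \<open>D \<le> m\<close>.\<close>

lemma exists_near_line:
  assumes Dm: "D \<le> m" and z: "z \<in> good" and q: "q \<in> Q z" and p: "p \<in> P" and cone: "\<bar>y p - y q\<bar> \<le> \<bar>x p - x q\<bar>"
  shows "\<exists>i\<in>{- int D..int D}. \<bar>y p - a (z, i) * x p - b (z, i)\<bar> \<le> 5 / real D"
proof -
  \<comment> \<open>If \<open>x p = x q\<close>, the cone condition gives \<open>y p = y q\<close>,
    and slope 0 serves.\<close>
  obtain \<mu> where mu: "y p - y q = \<mu> * (x p - x q)" "\<bar>\<mu>\<bar> \<le> 1"
  proof (cases "x p = x q")
    case True
    then show ?thesis using cone that[of 0] by simp
  next
    case False
    then show ?thesis using cone that[of "(y p - y q) / (x p - x q)"] by (simp add: abs_divide divide_le_eq_1)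
  qed
  define i where "i = \<lfloor>\<mu> * real D\<rfloor>"
  have mD: "\<bar>\<mu> * real D\<bar> \<le> real D" using mu(2) by (simp add: abs_mult mult_left_le_one_le)
  have i: "i \<in> {- int D..int D}" using mD unfolding i_def by (auto simp: le_floor_iff floor_le_iff abs_le_iff)
  define l where "l = (z, i)"
  have l: "l \<in> L" using z i by (simp add: l_def L_def)
  have "real_of_int i \<le> \<mu> * real D" "\<mu> * real D \<le> real_of_int i + 1" unfolding i_def by linarith+
  then have "real_of_int i / real D \<le> \<mu>" "\<mu> \<le> real_of_int i / real D + 1 / real D"
    using D_pos by (simp_all add: field_simps)
  moreover have "1 / (4 * real D) = (1 / real D) / 4" by simp
  ultimately have ma: "\<bar>\<mu> - a l\<bar> \<le> 5 / 4 * (1 / real D)" using slope[OF l] by (simp add: l_def abs_le_iff)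
  have mD': "1 / real m \<le> 1 / real D" using Dm D_pos by (simp add: frac_le)
  have Qq: "\<bar>y q - y (p1 l)\<bar> \<le> 1 / real m" "\<bar>x q - x (p1 l)\<bar> \<le> 1 / real m"
    using Q_bounds(2)[OF q] Q_bounds(2)[OF pair_props(1)[OF l]] by (auto simp: l_def)
  have "\<bar>(\<mu> - a l) * (x p - x q)\<bar> \<le> (5 / 4 * (1 / real D)) * 1" unfolding abs_mult
    using ma coords[OF p] coords[OF Q_bounds(1)[OF q]] by (intro mult_mono) auto
  moreover have "\<bar>a l * (x q - x (p1 l))\<bar> \<le> 2 * (1 / real m)" unfolding abs_mult
    using ab_bounds[OF l] Qq by (intro mult_mono) auto
  moreover have "y p - a l * x p - b l = (y q - y (p1 l)) + (\<mu> - a l) * (x p - x q) - a l * (x q - x (p1 l))"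
  proof -
    have "y p = y q + \<mu> * (x p - x q)" using mu(1) by simp
    then show ?thesis by (simp add: b_def algebra_simps)
  qed
  ultimately have "\<bar>y p - a l * x p - b l\<bar> \<le> 5 * (1 / real D)" using Qq(1) mD' by linarith
  then show ?thesis using i by (auto simp: l_def)
qed

text \<open>Of at least \<open>n\<^sup>2 / 2\<close> cone pairs, at most
  \<open>n\<^sup>2 / 4\<close> end in a bad cell. A good cell holds at most
  \<open>4 * C * n / m\<^sup>2\<close> points \<open>q\<close>, and every \<open>p\<close> seen from
  it is near one of its lines, which leaves at least \<open>n * m\<^sup>2 / (16 * C)\<close>
  incidences.\<close>

lemma weighted_incidences_coarse:
  assumes Dm: "D \<le> m"
  shows "real n * (real m)\<^sup>2 * real D / (640 * C) \<le> weighted_incidences P x y L a b (10 / real D)"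
proof -
  define Cn where "Cn = {(p, q). p \<in> P \<and> q \<in> P \<and> \<bar>y p - y q\<bar> \<le> \<bar>x p - x q\<bar>}"
  define R where "R z = {p \<in> P. \<exists>q\<in>Q z. \<bar>y p - y q\<bar> \<le> \<bar>x p - x q\<bar>}" for z
  define N where "N l = {p \<in> P. \<bar>y p - a l * x p - b l\<bar> \<le> 5 / real D}" for l
  have fin: "finite (R z)" "finite (Q z)" "finite (N l)" for z l by (auto simp: R_def Q_def N_def finite_P)
  have "Cn \<subseteq> P \<times> {q \<in> P. cell q \<notin> good} \<union> (\<Union>z\<in>good. R z \<times> Q z)"
    by (auto simp: Cn_def R_def Q_def)
  then have "card Cn \<le> card (P \<times> {q \<in> P. cell q \<notin> good} \<union> (\<Union>z\<in>good. R z \<times> Q z))"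
    by (rule card_mono[rotated]) (auto simp: finite_P finite_good fin)
  also have "\<dots> \<le> card (P \<times> {q \<in> P. cell q \<notin> good}) + card (\<Union>z\<in>good. R z \<times> Q z)" by (rule card_Un_le)
  also have "card (\<Union>z\<in>good. R z \<times> Q z) \<le> (\<Sum>z\<in>good. card (R z \<times> Q z))" by (rule card_UN_le[OF finite_good])
  finally have "card Cn \<le> n * card {q \<in> P. cell q \<notin> good} + (\<Sum>z\<in>good. card (R z) * card (Q z))"
    by (simp add: card_cartesian_product card_P)
  then have "real (card Cn) \<le> real n * real (card {q \<in> P. cell q \<notin> good}) + (\<Sum>z\<in>good. real (card (R z)) * real (card (Q z)))"
    by (simp only: of_nat_mult[symmetric] of_nat_sum[symmetric] of_nat_add[symmetric] of_nat_le_iff)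
  moreover have "real n * real (card {q \<in> P. cell q \<notin> good}) \<le> real n * (real n / 4)"
    by (intro mult_left_mono card_bad_le) simp
  moreover have "(real n)\<^sup>2 / 2 \<le> real (card Cn)" using cone unfolding Cn_def .
  ultimately have 1: "(real n)\<^sup>2 / 4 \<le> (\<Sum>z\<in>good. real (card (R z)) * real (card (Q z)))"
    by (simp add: power2_eq_square)
  also have "\<dots> \<le> (\<Sum>z\<in>good. real (card (R z)) * (4 * C * real n / (real m)\<^sup>2))"
    by (intro sum_mono mult_left_mono card_Q_le) simp
  also have "\<dots> = (\<Sum>z\<in>good. real (card (R z))) * (4 * C * real n / (real m)\<^sup>2)"
    by (rule sum_distrib_right[symmetric])
  also have "\<dots> \<le> (\<Sum>l\<in>L. real (card (N l))) * (4 * C * real n / (real m)\<^sup>2)"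
  proof (rule mult_right_mono)
    have "real (card (R z)) \<le> (\<Sum>i\<in>{- int D..int D}. real (card (N (z, i))))" if z: "z \<in> good" for z
    proof -
      have "R z \<subseteq> (\<Union>i\<in>{- int D..int D}. N (z, i))"
        using exists_near_line[OF Dm z] by (fastforce simp: R_def N_def)
      then have "card (R z) \<le> card (\<Union>i\<in>{- int D..int D}. N (z, i))"
        by (rule card_mono[rotated]) (auto simp: fin)
      also have "\<dots> \<le> (\<Sum>i\<in>{- int D..int D}. card (N (z, i)))" by (rule card_UN_le) simp
      finally show ?thesis by (simp only: of_nat_sum[symmetric] of_nat_le_iff)
    qed
    then have "(\<Sum>z\<in>good. real (card (R z))) \<le> (\<Sum>z\<in>good. \<Sum>i\<in>{- int D..int D}. real (card (N (z, i))))" by (rule sum_mono)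
    then show "(\<Sum>z\<in>good. real (card (R z))) \<le> (\<Sum>l\<in>L. real (card (N l)))"
      by (simp add: L_def sum.cartesian_product)
  qed (use C_pos in simp)
  finally have 2: "real n * (real m)\<^sup>2 / (16 * C) \<le> (\<Sum>l\<in>L. real (card (N l)))"
    using C_pos n_pos m_pos by (simp add: field_simps power2_eq_square)
  \<comment> \<open>A point within half the scale \<open>10 / D\<close> has weight at least
    \<open>(1 / 4) / (10 / D) = D / 40\<close>; with the 16 above this gives 640.\<close>
  have "(\<Sum>l\<in>L. real (card (N l))) * (real D / 40) = (\<Sum>l\<in>L. \<Sum>p\<in>P. if p \<in> N l then real D / 40 else 0)"
    using finite_P by (simp add: sum_distrib_right sum.If_cases N_def Int_def)
  also have "\<dots> \<le> (\<Sum>l\<in>L. \<Sum>p\<in>P. bump ((y p - a l * x p - b l) / (10 / real D)) ^ 4 / (10 / real D))"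
  proof (intro sum_mono)
    fix l p
    let ?t = "(y p - a l * x p - b l) / (10 / real D)"
    show "(if p \<in> N l then real D / 40 else 0) \<le> bump ?t ^ 4 / (10 / real D)"
    proof (cases "p \<in> N l")
      case True
      have "\<bar>?t\<bar> \<le> (5 / real D) / (10 / real D)" unfolding abs_divide
        using True D_pos by (intro frac_le) (auto simp: N_def)
      also have "\<dots> = 1 / 2" using D_pos by simp
      finally have "1 / 4 \<le> bump ?t ^ 4" by (rule bump_power4_ge)
      then have "(1 / 4) / (10 / real D) \<le> bump ?t ^ 4 / (10 / real D)" by (rule divide_right_mono) simp
      then show ?thesis using True by simp
    qed (simp add: bump_nonneg)
  qed
  also have "\<dots> = weighted_incidences P x y L a b (10 / real D)"
    unfolding weighted_incidences_def by (rule sum.swap)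
  finally have 3: "(\<Sum>l\<in>L. real (card (N l))) * (real D / 40) \<le> weighted_incidences P x y L a b (10 / real D)" .
  have "real n * (real m)\<^sup>2 * real D / (640 * C) = real n * (real m)\<^sup>2 / (16 * C) * (real D / 40)" by simp
  also have "\<dots> \<le> (\<Sum>l\<in>L. real (card (N l))) * (real D / 40)" by (intro mult_right_mono 2) simp
  finally show ?thesis using 3 by linarith
qed

text \<open>By \<open>far\<close> only the two spanning points of each line contribute at scale
  \<open>w1\<close>, each at most \<open>1 / w1\<close>.\<close>

lemma weighted_incidences_fine: "weighted_incidences P x y L a b w1 \<le> 24 * (real m)\<^sup>2 * real D / w1"
proof -
  have "(\<Sum>p\<in>P. bump ((y p - a l * x p - b l) / w1) ^ 4 / w1) \<le> 2 / w1" if l: "l \<in> L" for l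
  proof -
    have "(\<Sum>p\<in>P. bump ((y p - a l * x p - b l) / w1) ^ 4 / w1) = (\<Sum>p\<in>{p1 l, p2 l}. bump ((y p - a l * x p - b l) / w1) ^ 4 / w1)"
    proof (rule sum.mono_neutral_right[OF finite_P])
      show "{p1 l, p2 l} \<subseteq> P" using pair_dx[OF l] by simp
      show "\<forall>p\<in>P - {p1 l, p2 l}. bump ((y p - a l * x p - b l) / w1) ^ 4 / w1 = 0"
      proof
        fix p assume "p \<in> P - {p1 l, p2 l}"
        then have "w1 < \<bar>y p - a l * x p - b l\<bar>" using far[OF l] by auto
        then have "1 \<le> \<bar>(y p - a l * x p - b l) / w1\<bar>" using w1_pos by (simp add: abs_divide)
        then show "bump ((y p - a l * x p - b l) / w1) ^ 4 / w1 = 0" by (simp add: bump_eq_0)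
      qed
    qed
    also have "\<dots> \<le> (\<Sum>p\<in>{p1 l, p2 l}. 1 / w1)"
      using w1_pos by (intro sum_mono divide_right_mono power_le_one bump_nonneg bump_le_1) auto
    also have "\<dots> = 2 / w1" using pair_dx(5)[OF l] by simp
    finally show ?thesis .
  qed
  then have "(\<Sum>l\<in>L. \<Sum>p\<in>P. bump ((y p - a l * x p - b l) / w1) ^ 4 / w1) \<le> (\<Sum>l\<in>L. 2 / w1)" by (rule sum_mono)
  also have "\<dots> = real (card L) * (2 / w1)" by simp
  also have "\<dots> \<le> 12 * (real m)\<^sup>2 * real D * (2 / w1)" using w1_pos by (intro mult_right_mono card_L_le) simp
  finally show ?thesis unfolding weighted_incidences_def by (subst sum.swap) simp
qed

text \<open>Carries the incidence count from scale \<open>10 / D\<close> down to \<open>w1\<close>.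
  The scale \<open>v\<close> separates the two counts of lines: the coarse one is used above
  \<open>v\<close>, the fine one below, where \<open>vn\<close> makes it no worse.\<close>

lemma main_inequality:
  assumes Dm: "D \<le> m" and D10: "10 \<le> D" and w1D: "w1 \<le> 10 / real D" and J: "4 \<le> 2 ^ J * w1" and v: "1 / real m \<le> v"
    and vn: "v * real n + 1 / w1 \<le> 3 * real n * (real m)\<^sup>2 * w1\<^sup>2"
  shows "real n * (real m)\<^sup>2 * real D / (640 * C) \<le> 24 * (real m)\<^sup>2 * real D / w1 +
    sqrt (1152 * 504\<^sup>2 * 40128 * C * (real n)\<^sup>2 * (real m) ^ 4 * real D * (real J + 1)) * ln (10 / real D / w1)"
proof -
  define A0 :: real where "A0 = 1152 * 504\<^sup>2"
  have A0: "0 < A0" by (simp add: A0_def)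
  \<comment> \<open>\<open>40128 = 12 * 4 * 836\<close>: the constants of the number of lines, of
    the points in a square and of the coarse line count.\<close>
  define Z where "Z = A0 * 40128 * C * (real n)\<^sup>2 * (real m) ^ 4 * real D * (real J + 1)"
  have Z0: "0 \<le> Z" using C_pos A0 by (simp add: Z_def)
  have "(\<Sum>p\<in>P. \<Sum>l\<in>L. bump_deriv 2 ((y p - a l * x p - b l) / w))\<^sup>2 \<le> (sqrt Z * w)\<^sup>2" if w: "w1 \<le> w" "w \<le> 10 / real D" for w
  proof -
    have w0: "0 < w" using w w1_pos by simp
    have "10 / real D \<le> 1" using D10 by simp
    then have wle1: "w \<le> 1" using w by simp
    have Jw: "4 \<le> 2 ^ J * w" by (rule order_trans[OF J mult_left_mono[OF w(1)]]) simp
    have MPw: "real (card {p \<in> P. X \<le> x p \<and> x p \<le> X + w \<and> Y \<le> y p \<and> y p \<le> Y + w}) \<le> C * (w * sqrt n + 1)\<^sup>2" for X Y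
      using card_square_le[of w X Y] w0 by simp
    have hf: "(\<Sum>p\<in>P. \<Sum>l\<in>L. bump_deriv 2 ((y p - a l * x p - b l) / w))\<^sup>2
        \<le> A0 * real n * (12 * (real m)\<^sup>2 * real D) * MP * M * (real J + 1) / w"
      if MP: "C * (w * sqrt n + 1)\<^sup>2 \<le> MP" and M0: "0 \<le> M"
        and M: "\<And>l r. l \<in> L \<Longrightarrow> w \<le> r \<Longrightarrow>
          real (card {l' \<in> L. \<bar>a l' - a l\<bar> \<le> r \<and> \<bar>b l' - b l\<bar> \<le> 5 * r}) \<le> M * (r / w)\<^sup>2" for MP M
    proof -
      have MP0: "0 \<le> MP" using MP C_pos by (smt (verit) mult_nonneg_nonneg zero_le_power2)
      have "(\<Sum>p\<in>P. \<Sum>l\<in>L. bump_deriv 2 ((y p - a l * x p - b l) / w))\<^sup>2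
        \<le> A0 * real n * real (card L) * MP * M * (real J + 1) / w"
        using high_frequency_bound[OF w0 wle1 finite_L finite_P coords ab_bounds order_trans[OF MPw MP] M Jw]
        by (simp only: A0_def card_P)
      also have "\<dots> \<le> A0 * real n * (12 * (real m)\<^sup>2 * real D) * MP * M * (real J + 1) / w"
        using w0 A0 MP0 M0 by (intro divide_right_mono mult_right_mono mult_left_mono card_L_le) auto
      finally show ?thesis .
    qed
    have "(\<Sum>p\<in>P. \<Sum>l\<in>L. bump_deriv 2 ((y p - a l * x p - b l) / w))\<^sup>2 \<le> Z * w\<^sup>2"
    proof (cases "v \<le> w")
      case True
      have mw: "1 / real m \<le> w" using v True by simp
      have "1 \<le> w * real m" using mw m_pos by (simp add: field_simps)
      also have "\<dots> \<le> w * sqrt n" using K_ge_1 w0 by (intro mult_left_mono) auto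
      finally have wn: "1 \<le> w * sqrt n" .
      have "(w * sqrt n + 1)\<^sup>2 \<le> (2 * (w * sqrt n))\<^sup>2" using wn by (intro power_mono) auto
      then have "C * (w * sqrt n + 1)\<^sup>2 \<le> C * (2 * (w * sqrt n))\<^sup>2" using C_pos by (intro mult_left_mono) auto
      also have "\<dots> = 4 * C * real n * w\<^sup>2" by (simp add: power_mult_distrib)
      finally have MP: "C * (w * sqrt n + 1)\<^sup>2 \<le> 4 * C * real n * w\<^sup>2" .
      have M: "real (card {l' \<in> L. \<bar>a l' - a l\<bar> \<le> r \<and> \<bar>b l' - b l\<bar> \<le> 5 * r}) \<le> 836 * (real m)\<^sup>2 * w * (r / w)\<^sup>2"
        if "l \<in> L" "w \<le> r" for l r
      proof -
        have r1: "1 / real m \<le> r" using mw that by simp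
        \<comment> \<open>With \<open>w * D \<le> 10\<close> and \<open>w \<le> r\<close> the factor
          \<open>1 + r * D\<close> costs at most \<open>11 * r / w\<close>;
          \<open>836 = 76 * 11\<close>.\<close>
        have "r * w \<le> r * r" using that w0 by (intro mult_left_mono) auto
        moreover have "w * real D \<le> 10" using w(2) D_pos by (simp add: field_simps)
        then have "r * r * (w * real D) \<le> r * r * 10" by (intro mult_left_mono) auto
        ultimately have "r * (1 + r * real D) * w \<le> 11 * (r * r)" by (simp add: algebra_simps)
        then have "r * (1 + r * real D) \<le> 11 * (r * r) / w" using w0 by (simp add: field_simps)
        also have "\<dots> = 11 * w * (r / w)\<^sup>2" using w0 by (simp add: power2_eq_square)
        finally have *: "76 * (real m)\<^sup>2 * (r * (1 + r * real D)) \<le> 76 * (real m)\<^sup>2 * (11 * w * (r / w)\<^sup>2)"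
          by (rule mult_left_mono) simp
        note count_lines_coarse[OF that(1) r1]
        also have "76 * r * (real m)\<^sup>2 * (1 + r * real D) = 76 * (real m)\<^sup>2 * (r * (1 + r * real D))" by simp
        also note *
        also have "76 * (real m)\<^sup>2 * (11 * w * (r / w)\<^sup>2) = 836 * (real m)\<^sup>2 * w * (r / w)\<^sup>2" by simp
        finally show ?thesis .
      qed
      have eq: "A0 * real n * (12 * (real m)\<^sup>2 * real D) * (4 * C * real n * w\<^sup>2) * (836 * (real m)\<^sup>2 * w) * (real J + 1) / w = Z * w\<^sup>2"
        using w0 by (simp add: Z_def eval_nat_numeral)
      have M0: "0 \<le> 836 * (real m)\<^sup>2 * w" using w0 by simp
      show ?thesis using hf[OF MP M0 M] unfolding eq .
    next
      case False
      have "(w * sqrt n + 1)\<^sup>2 \<le> 2 * (w\<^sup>2 * real n + 1)"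
      proof -
        have "0 \<le> (w * sqrt n - 1)\<^sup>2" by simp
        then show ?thesis by (simp add: power2_diff power2_sum power_mult_distrib mult.commute)
      qed
      then have MP: "C * (w * sqrt n + 1)\<^sup>2 \<le> C * (2 * (w\<^sup>2 * real n + 1))" using C_pos by (intro mult_left_mono) auto
      have M: "real (card {l' \<in> L. \<bar>a l' - a l\<bar> \<le> r \<and> \<bar>b l' - b l\<bar> \<le> 5 * r}) \<le> 420 * (w / w1)\<^sup>2 * (r / w)\<^sup>2"
        if "l \<in> L" "w \<le> r" for l r
        using count_lines_fine[OF that(1), of r] that(2) w(1) w0 by (simp add: power_divide)
      \<comment> \<open>\<open>10080 = 12 * 2 * 420\<close>; the factor 3 from \<open>vn\<close>
        makes it 30240, still below 40128.\<close>
      define X where "X = A0 * 10080 * C * real n * (real m)\<^sup>2 * real D * (real J + 1)"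
      have X0: "0 \<le> X" using C_pos A0 by (simp add: X_def)
      have "(\<Sum>p\<in>P. \<Sum>l\<in>L. bump_deriv 2 ((y p - a l * x p - b l) / w))\<^sup>2
         \<le> A0 * real n * (12 * (real m)\<^sup>2 * real D) * (C * (2 * (w\<^sup>2 * real n + 1))) * (420 * (w / w1)\<^sup>2) * (real J + 1) / w"
        using hf[OF MP _ M] by simp
      also have "\<dots> = X * (w\<^sup>2 * ((w * real n + 1 / w) / w1\<^sup>2))"
        using w0 w1_pos by (simp add: X_def field_simps power2_eq_square)
      also have "\<dots> \<le> X * (w\<^sup>2 * (3 * real n * (real m)\<^sup>2))"
      proof -
        have "w * real n \<le> v * real n" using False by (intro mult_right_mono) auto
        moreover have "1 / w \<le> 1 / w1" using w w1_pos by (simp add: frac_le)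
        ultimately have "w * real n + 1 / w \<le> 3 * real n * (real m)\<^sup>2 * w1\<^sup>2" using vn by linarith
        then have "(w * real n + 1 / w) / w1\<^sup>2 \<le> 3 * real n * (real m)\<^sup>2"
          using w1_pos by (simp add: divide_le_eq)
        then show ?thesis using X0 by (intro mult_left_mono) auto
      qed
      also have "\<dots> = A0 * 30240 * C * (real n)\<^sup>2 * (real m) ^ 4 * real D * (real J + 1) * w\<^sup>2"
        by (simp add: X_def power2_eq_square eval_nat_numeral)
      also have "\<dots> \<le> Z * w\<^sup>2" unfolding Z_def
        using C_pos A0 by (intro mult_right_mono) auto
      finally show ?thesis .
    qed
    then show ?thesis using Z0 by (simp add: power_mult_distrib)
  qed
  from weighted_incidences_le[OF w1_pos w1D _ this]
  have "weighted_incidences P x y L a b (10 / real D) \<le> weighted_incidences P x y L a b w1 + sqrt Z * ln (10 / real D / w1)"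
    using Z0 by simp
  then show ?thesis
    using weighted_incidences_coarse[OF Dm] weighted_incidences_fine unfolding Z_def A0_def by linarith
qed

end

section \<open>Choice of parameters\<close>

text \<open>Suppose every triangle is large. The coarse count is at least
  \<open>G / (640 * C)\<close> with \<open>G = n * m\<^sup>2 * D\<close>, whereas the fine count is
  smaller than \<open>G\<close> by a power of \<open>n\<close>, and the change between the scales by
  a factor of about \<open>sqrt D\<close> up to logarithms. Since \<open>D\<close> is of order
  \<open>n powr (\<epsilon> / 2)\<close>, this fails for large \<open>n\<close>.\<close>

lemma homogeneous_points_small_det:
  fixes C \<epsilon> :: real
  assumes C: "1 \<le> C" and \<epsilon>: "0 < \<epsilon>" "\<epsilon> \<le> 1 / 3"
  shows "\<exists>N::nat. \<forall>n\<ge>N. \<forall>(P :: 'p set) x y. homogeneous_points P x y C (1 / sqrt (real n)) \<longrightarrow> card P = n \<longrightarrow>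
    (real n)\<^sup>2 / 2 \<le> real (card {(p, q). p \<in> P \<and> q \<in> P \<and> \<bar>y p - y q\<bar> \<le> \<bar>x p - x q\<bar>}) \<longrightarrow>
    (\<exists>p\<in>P. \<exists>q\<in>P. \<exists>r\<in>P. p \<noteq> q \<and> p \<noteq> r \<and> q \<noteq> r \<and>
       \<bar>(x q - x p) * (y r - y p) - (y q - y p) * (x r - x p)\<bar> \<le> 2 * real n powr (-7/6 + \<epsilon>))"
proof -
  define B where "B = 1152 * 504\<^sup>2 * 40128 * C * (6144 * C)"
  have B0: "0 < B" using C by (simp add: B_def)
  have d0: "0 < \<epsilon> / 2" using \<epsilon> by simp
  have "((\<lambda>t::real. 24 * t powr (-1/3)) \<longlongrightarrow> 0) at_top" by real_asymp
  moreover have "((\<lambda>t::real. sqrt (B * (2 * ln t + 4) / t powr \<delta>) * ln t) \<longlongrightarrow> 0) at_top" if "0 < \<delta>" for \<delta>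
    using B0 that by real_asymp
  ultimately have "((\<lambda>t::real. 24 * t powr (-1/3) + sqrt (B * (2 * ln t + 4) / t powr (\<epsilon>/2)) * ln t) \<longlongrightarrow> 0) at_top"
    using d0 by (intro tendsto_add_zero)
  then have "\<forall>\<^sub>F t in at_top. 24 * t powr (-1/3) + sqrt (B * (2 * ln t + 4) / t powr (\<epsilon>/2)) * ln t < 1 / (640 * C)"
    using C by (intro order_tendstoD(2)) auto
  moreover have "filterlim (\<lambda>t::real. t powr \<delta>) at_top at_top" if "0 < \<delta>" for \<delta> using that by real_asymp
  then have "\<forall>\<^sub>F t in at_top. 61440 * C \<le> t powr (\<epsilon>/2)" using d0 by (simp add: filterlim_at_top)
  moreover have "\<forall>\<^sub>F t in at_top. (1::real) \<le> t" by (rule eventually_ge_at_top)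
  ultimately have "\<forall>\<^sub>F t in at_top. 24 * t powr (-1/3) + sqrt (B * (2 * ln t + 4) / t powr (\<epsilon>/2)) * ln t < 1 / (640 * C) \<and>
      61440 * C \<le> t powr (\<epsilon>/2) \<and> 1 \<le> t"
    by eventually_elim blast
  then obtain t0 where t0: "\<And>t. t0 \<le> t \<Longrightarrow> 24 * t powr (-1/3) + sqrt (B * (2 * ln t + 4) / t powr (\<epsilon>/2)) * ln t < 1 / (640 * C) \<and>
      61440 * C \<le> t powr (\<epsilon>/2) \<and> 1 \<le> t"
    unfolding eventually_at_top_linorder by blast
  show ?thesis
  proof (intro exI[of _ "nat \<lceil>t0\<rceil>"] allI impI)
    fix n :: nat and P :: "'p set" and x y :: "'p \<Rightarrow> real"
    assume n: "nat \<lceil>t0\<rceil> \<le> n" and hp: "homogeneous_points P x y C (1 / sqrt (real n))" and cP: "card P = n"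
      and cone: "(real n)\<^sup>2 / 2 \<le> real (card {(p, q). p \<in> P \<and> q \<in> P \<and> \<bar>y p - y q\<bar> \<le> \<bar>x p - x q\<bar>})"
    define \<nu> where "\<nu> = real n"
    have "t0 \<le> \<nu>" using n by (simp add: \<nu>_def nat_le_iff ceiling_le_iff)
    from t0[OF this] have nu1: "1 \<le> \<nu>" and klb: "61440 * C \<le> \<nu> powr (\<epsilon>/2)"
      and small: "24 * \<nu> powr (-1/3) + sqrt (B * (2 * ln \<nu> + 4) / \<nu> powr (\<epsilon>/2)) * ln \<nu> < 1 / (640 * C)" by auto
    have nu0: "0 < \<nu>" using nu1 by simp
    \<comment> \<open>\<open>k\<close> is the cell side in units of \<open>1 / sqrt n\<close> and
      \<open>u\<close> the number of cells per side, before rounding: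
      \<open>k * u = sqrt \<nu>\<close>. After rounding, \<open>K\<close> lies between
      \<open>k / 2\<close> and \<open>k\<close>, and \<open>D\<close> is of order
      \<open>k / C\<close>.\<close>
    define k where "k = \<nu> powr (\<epsilon>/2)"
    define u where "u = \<nu> powr (1/2 - \<epsilon>/2)"
    define \<Delta> where "\<Delta> = \<nu> powr (-7/6 + \<epsilon>)"
    define m where "m = nat \<lceil>u\<rceil>"
    define K where "K = sqrt \<nu> / real m"
    define T where "T = nat \<lfloor>K\<^sup>2 / (64 * C)\<rfloor>"
    define D where "D = nat \<lfloor>real T / (12 * K)\<rfloor>"
    \<comment> \<open>Chosen so that \<open>w1 / m\<close> is the determinant
      \<open>2 * \<Delta>\<close> of a triangle of area \<open>\<Delta>\<close>.\<close>
    define w1 where "w1 = 2 * \<Delta> * real m"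
    define J where "J = nat \<lceil>log 2 (4 * \<nu>)\<rceil>"
    have \<Delta>0: "0 < \<Delta>" using nu0 by (simp add: \<Delta>_def)
    have klb: "61440 * C \<le> k" using klb by (simp add: k_def)
    have k0: "61440 \<le> k" using klb C by linarith
    have u1: "1 \<le> u" using nu1 \<epsilon> unfolding u_def by (intro ge_one_powr_ge_zero) auto
    have ku: "k * u = sqrt \<nu>"
      using nu0 by (simp add: k_def u_def powr_half_sqrt flip: powr_add)
    have "real m = real_of_int \<lceil>u\<rceil>" using u1 by (simp add: m_def)
    then have um: "u \<le> real m" and mu: "real m \<le> 2 * u" using u1 by linarith+
    have m0: "0 < real m" using um u1 by simp
    have Kk: "K \<le> k" using ku mult_left_mono[OF um, of k] k0 m0 by (simp add: K_def divide_le_eq)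
    have "k * real m \<le> k * (2 * u)" using mu k0 by (intro mult_left_mono) auto
    also have "\<dots> = 2 * sqrt \<nu>" using ku by simp
    finally have kK: "k / 2 \<le> K" using m0 by (simp add: K_def field_simps)
    have KC: "30720 * C \<le> K" using klb kK by linarith
    have K1: "1 \<le> K" using KC C by linarith
    have K2: "30720 * C \<le> K\<^sup>2"
      using KC mult_mono[OF KC K1] K1 C by (simp add: power2_eq_square)
    have floor_bounds: "real (nat \<lfloor>X\<rfloor>) \<le> X \<and> X / 2 \<le> real (nat \<lfloor>X\<rfloor>) \<and> 1 \<le> real (nat \<lfloor>X\<rfloor>)" if "2 \<le> X" for X :: real
    proof -
      have "real (nat \<lfloor>X\<rfloor>) = real_of_int \<lfloor>X\<rfloor>" using that by simp
      then show ?thesis using that by linarith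
    qed
    have "2 \<le> K\<^sup>2 / (64 * C)" using K2 C by (simp add: le_divide_eq)
    from floor_bounds[OF this]
    have Tu: "real T \<le> K\<^sup>2 / (64 * C)" and Tl: "K\<^sup>2 / (64 * C) / 2 \<le> real T" and T0: "1 \<le> real T"
      unfolding T_def by blast+
    have "K / (1536 * C) = K\<^sup>2 / (64 * C) / 2 / (12 * K)" using K1 C by (simp add: power2_eq_square)
    also have "\<dots> \<le> real T / (12 * K)" using Tl K1 by (intro divide_right_mono) auto
    finally have TK: "K / (1536 * C) \<le> real T / (12 * K)" .
    have k10: "10 \<le> k / (6144 * C)" using klb C by (simp add: le_divide_eq)
    have "2 * (k / (6144 * C)) = (k / 2) / (1536 * C)" by simp
    also have "\<dots> \<le> K / (1536 * C)" using kK C by (intro divide_right_mono) auto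
    finally have TK': "2 * (k / (6144 * C)) \<le> real T / (12 * K)" using TK by simp
    have "2 \<le> real T / (12 * K)" by (rule order_trans[OF _ TK']) (use k10 in simp)
    from floor_bounds[OF this]
    have Du: "real D \<le> real T / (12 * K)" and Dl: "real T / (12 * K) / 2 \<le> real D" unfolding D_def by blast+
    have "k / (6144 * C) \<le> real T / (12 * K) / 2" using TK' by simp
    then have Dk: "k / (6144 * C) \<le> real D" using Dl by (rule order_trans)
    have D10: "10 \<le> real D" using k10 Dk by (rule order_trans)
    have "real T / (12 * K) \<le> K\<^sup>2 / (64 * C) / (12 * K)" using Tu K1 by (intro divide_right_mono) auto
    also have "\<dots> = K / (768 * C)" using K1 C by (simp add: power2_eq_square)
    also have "\<dots> \<le> K / 1" using K1 C by (intro divide_left_mono) auto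
    finally have DK: "real D \<le> k" using Du Kk by linarith
    have "k \<le> u" unfolding k_def u_def using nu1 \<epsilon> by (intro powr_mono) auto
    then have Dm: "D \<le> m" using DK um by linarith
    have w1l: "\<nu> powr (-2/3) \<le> w1" and w1u: "w1 \<le> 4 * \<nu> powr (-2/3 + \<epsilon>/2)"
    proof -
      have du: "\<Delta> * u = \<nu> powr (-2/3 + \<epsilon>/2)" by (simp add: \<Delta>_def u_def flip: powr_add)
      have "\<nu> powr (-2/3) \<le> \<nu> powr (-2/3 + \<epsilon>/2)" using nu1 \<epsilon> by (intro powr_mono) auto
      moreover have "\<Delta> * u \<le> \<Delta> * real m" "\<Delta> * real m \<le> \<Delta> * (2 * u)" using um mu \<Delta>0 by (auto intro: mult_left_mono)
      moreover have "0 \<le> \<nu> powr (-2/3)" by simp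
      ultimately show "\<nu> powr (-2/3) \<le> w1" "w1 \<le> 4 * \<nu> powr (-2/3 + \<epsilon>/2)" using du by (simp_all add: w1_def)
    qed
    have w10: "0 < w1" using \<Delta>0 m0 by (simp add: w1_def)
    show "\<exists>p\<in>P. \<exists>q\<in>P. \<exists>r\<in>P. p \<noteq> q \<and> p \<noteq> r \<and> q \<noteq> r \<and>
       \<bar>(x q - x p) * (y r - y p) - (y q - y p) * (x r - x p)\<bar> \<le> 2 * real n powr (-7/6 + \<epsilon>)"
    proof (rule ccontr)
      assume neg: "\<not> ?thesis"
      have nm: "\<nu> / (real m)\<^sup>2 = K\<^sup>2" using nu0 by (simp add: K_def power_divide)
      interpret homogeneous_points P x y C "1 / sqrt (real n)" by (rule hp)
      interpret heilbronn_config P x y C n w1 m T D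
      proof
        show "0 < n" using nu0 by (simp add: \<nu>_def)
        show "0 < m" using m0 by simp
        show "0 < T" using T0 by simp
        show "0 < D" using D10 by simp
        show "real m \<le> sqrt (real n)" using K1 m0 by (simp add: K_def \<nu>_def le_divide_eq)
        have "2 * C * (real T + 1) = 2 * C * real T + 2 * C" by (simp add: algebra_simps)
        also have "2 * C * real T \<le> 2 * C * (K\<^sup>2 / (64 * C))" using Tu C by (intro mult_left_mono) auto
        also have "\<dots> = K\<^sup>2 / 32" using C by simp
        also have "K\<^sup>2 / 32 + 2 * C < K\<^sup>2 / 16" using K2 C by simp
        finally show "2 * C * (real T + 1) < real n / (16 * (real m)\<^sup>2)"
          using nm by (simp add: \<nu>_def)
        have "12 * K * real D \<le> real T" using Du K1 by (simp add: le_divide_eq mult.commute)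
        then show "12 * sqrt (real n) / real m * real D \<le> real T" by (simp add: K_def \<nu>_def)
        show "w1 / real m < \<bar>(x q - x p) * (y r - y p) - (y q - y p) * (x r - x p)\<bar>"
          if "p \<in> P" "q \<in> P" "r \<in> P" "p \<noteq> q" "p \<noteq> r" "q \<noteq> r" for p q r
          using neg that m0 by (force simp: w1_def \<Delta>_def \<nu>_def not_le)
      qed (use cP cone w10 in auto)
      have D1: "10 / real D \<le> 1" using D10 by simp
      have w1D: "w1 \<le> 10 / real D"
      proof -
        have "w1 \<le> 4 * \<nu> powr (- (\<epsilon>/2))"
          using w1u powr_mono[of "-2/3 + \<epsilon>/2" "- (\<epsilon>/2)" \<nu>] nu1 \<epsilon> by linarith
        also have "\<dots> = 4 / k" by (simp add: k_def powr_minus_divide)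
        also have "\<dots> \<le> 10 / real D" using DK D10 by (intro frac_le) auto
        finally show ?thesis .
      qed
      have w1inv: "1 / w1 \<le> \<nu> powr (2/3)"
      proof -
        have "1 / w1 \<le> 1 / \<nu> powr (-2/3)" using w1l nu0 by (intro divide_left_mono) (auto simp: w10)
        also have "\<dots> = \<nu> powr (2/3)" by (simp add: powr_minus_divide)
        finally show ?thesis .
      qed
      have pw: "\<nu> powr (2/3) \<le> \<nu>" using powr_mono[of "2/3" 1 \<nu>] nu1 by simp
      have lg: "4 * \<nu> = 2 powr (log 2 (4 * \<nu>))" using nu0 by simp
      have J4: "4 * \<nu> \<le> 2 ^ J"
      proof -
        have "log 2 (4 * \<nu>) \<le> real J" unfolding J_def by linarith
        then have "2 powr (log 2 (4 * \<nu>)) \<le> 2 powr (real J)" by (intro powr_mono) auto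
        then show ?thesis using lg by (simp add: powr_realpow)
      qed
      have "4 * \<nu> * (1 / \<nu>) \<le> 2 ^ J * w1"
      proof (rule mult_mono[OF J4])
        have "1 / w1 \<le> \<nu>" using w1inv pw by linarith
        then show "1 / \<nu> \<le> w1" using nu0 w10 by (simp add: field_simps)
      qed (use nu0 in auto)
      then have J: "4 \<le> 2 ^ J * w1" using nu0 by simp
      \<comment> \<open>The threshold scale is \<open>\<nu> powr (-1/3)\<close>;
        \<open>\<epsilon> \<le> 1 / 3\<close> is exactly what keeps it above the cell side.\<close>
      have v: "1 / real m \<le> \<nu> powr (-1/3)"
      proof -
        have "1 / real m \<le> 1 / u" using um u1 by (intro divide_left_mono) auto
        also have "\<dots> = \<nu> powr (- (1/2 - \<epsilon>/2))" unfolding u_def by (simp only: powr_minus_divide)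
        also have "\<dots> \<le> \<nu> powr (-1/3)" using nu1 \<epsilon> by (intro powr_mono) auto
        finally show ?thesis .
      qed
      have vn: "\<nu> powr (-1/3) * real n + 1 / w1 \<le> 3 * real n * (real m)\<^sup>2 * w1\<^sup>2"
      proof -
        have 1: "\<nu> powr (-1/3) * \<nu> = \<nu> powr (2/3)"
          using nu0 powr_add[of \<nu> "-1/3" 1] by simp
        \<comment> \<open>The exponent 7/6 is decided here: \<open>m\<^sup>2 * \<Delta>\<close> is
          at least \<open>\<nu> powr (-1/6)\<close>, so \<open>\<nu> * (m * w1)\<^sup>2\<close> is
          at least \<open>\<nu> powr (2/3)\<close>, which matches both terms on the left of
          \<open>vn\<close>.\<close>
        have "\<nu> powr (1/2 - \<epsilon>/2) * \<nu> powr (1/2 - \<epsilon>/2) * \<nu> powr (-7/6 + \<epsilon>) = \<nu> powr (-1/6)"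
          by (simp flip: powr_add)
        then have "u * u * \<Delta> = \<nu> powr (-1/6)" by (simp add: u_def \<Delta>_def)
        moreover have "u * u * \<Delta> \<le> real m * real m * \<Delta>" using um u1 \<Delta>0 by (intro mult_mono) auto
        moreover have "real m * w1 = 2 * (real m * real m * \<Delta>)" by (simp add: w1_def)
        moreover have "0 \<le> real m * real m * \<Delta>" using \<Delta>0 by simp
        ultimately have "\<nu> powr (-1/6) \<le> real m * w1" by linarith
        then have "(\<nu> powr (-1/6))\<^sup>2 \<le> (real m * w1)\<^sup>2" by (rule power_mono) simp
        moreover have "(\<nu> powr (-1/6))\<^sup>2 = \<nu> powr (-1/3)" by (simp add: power2_eq_square flip: powr_add)
        ultimately have "\<nu> powr (-1/3) \<le> (real m)\<^sup>2 * w1\<^sup>2" by (simp only: power_mult_distrib)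
        then have "\<nu> * \<nu> powr (-1/3) \<le> \<nu> * ((real m)\<^sup>2 * w1\<^sup>2)" using nu0 by (intro mult_left_mono) auto
        moreover have "\<nu> * \<nu> powr (-1/3) = \<nu> powr (2/3)" using 1 by (simp only: mult.commute)
        ultimately have "3 * (\<nu> powr (2/3)) \<le> 3 * (\<nu> * ((real m)\<^sup>2 * w1\<^sup>2))" by simp
        then have "3 * (\<nu> powr (2/3)) \<le> 3 * \<nu> * (real m)\<^sup>2 * w1\<^sup>2" by (simp only: mult.assoc)
        moreover have "0 \<le> \<nu> powr (2/3)" by simp
        ultimately show ?thesis using 1 w1inv unfolding \<nu>_def[symmetric] by linarith
      qed
      define G where "G = \<nu> * (real m)\<^sup>2 * real D"
      have G0: "0 < G" using nu0 m0 D10 by (simp add: G_def)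
      have "G / (640 * C) \<le> 24 * (real m)\<^sup>2 * real D / w1 +
        sqrt (1152 * 504\<^sup>2 * 40128 * C * \<nu>\<^sup>2 * (real m) ^ 4 * real D * (real J + 1)) * ln (10 / real D / w1)"
        using main_inequality[OF Dm _ w1D J v vn] D10 by (simp add: G_def \<nu>_def)
      also have "24 * (real m)\<^sup>2 * real D / w1 = G * (24 * (1 / w1 / \<nu>))" using nu0 by (simp add: G_def)
      also have "\<dots> \<le> G * (24 * \<nu> powr (-1/3))"
      proof -
        have "1 / w1 / \<nu> \<le> \<nu> powr (2/3) / \<nu>" using w1inv nu0 by (intro divide_right_mono) auto
        also have "\<dots> = \<nu> powr (2/3 - 1)" 
          unfolding powr_diff powr_one[OF order_less_imp_le[OF nu0]] ..
        also have "(2/3 - 1 :: real) = -1/3" by simp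
        finally show ?thesis using G0 by (intro mult_left_mono) auto
      qed
      also have "sqrt (1152 * 504\<^sup>2 * 40128 * C * \<nu>\<^sup>2 * (real m) ^ 4 * real D * (real J + 1)) * ln (10 / real D / w1)
          \<le> G * (sqrt (B * (2 * ln \<nu> + 4) / k) * ln \<nu>)"
      proof -
        \<comment> \<open>Pulling \<open>G\<close> out of the root leaves
          \<open>(J + 1) / D\<close>: the gain is \<open>1 / sqrt D\<close>, against the logarithmic
          size of \<open>J\<close>.\<close>
        have "1152 * 504\<^sup>2 * 40128 * C * \<nu>\<^sup>2 * (real m) ^ 4 * real D * (real J + 1) = G\<^sup>2 * (1152 * 504\<^sup>2 * 40128 * C * ((real J + 1) / real D))"
          using D10 by (simp add: G_def power2_eq_square power4_eq_xxxx)
        then have s1: "sqrt (1152 * 504\<^sup>2 * 40128 * C * \<nu>\<^sup>2 * (real m) ^ 4 * real D * (real J + 1)) =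
            G * sqrt (1152 * 504\<^sup>2 * 40128 * C * ((real J + 1) / real D))"
          using G0 by (simp only: real_sqrt_mult real_sqrt_abs abs_of_pos)
        have "real J + 1 \<le> 2 * ln \<nu> + 4"
        proof -
          have "0 \<le> log 2 (4 * \<nu>)" using nu1 by simp
          then have "real J = real_of_int \<lceil>log 2 (4 * \<nu>)\<rceil>" by (simp add: J_def)
          then have "real J \<le> log 2 (4 * \<nu>) + 1" by linarith
          also have "log 2 (4 * \<nu>) = 2 + ln \<nu> / ln 2"
          proof -
            have "log 2 (4 * \<nu>) = log 2 (2 ^ 2) + log 2 \<nu>" using nu0 by (simp add: log_mult)
            also have "log 2 ((2::real) ^ 2) = 2" by (subst log_nat_power) auto
            finally show ?thesis by (simp add: log_def)
          qed
          also have "ln \<nu> / ln 2 \<le> ln \<nu> / (1 / 2)"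
            using nu1 ln2_ge_two_thirds by (intro divide_left_mono) auto
          finally show ?thesis by simp
        qed
        moreover have "1 / real D \<le> 6144 * C / k"
          using Dk k0 C D10 by (simp add: field_simps)
        ultimately have "(real J + 1) * (1 / real D) \<le> (2 * ln \<nu> + 4) * (6144 * C / k)"
          using nu1 by (intro mult_mono) auto
        then have "1152 * 504\<^sup>2 * 40128 * C * ((real J + 1) * (1 / real D)) \<le> 1152 * 504\<^sup>2 * 40128 * C * ((2 * ln \<nu> + 4) * (6144 * C / k))"
          using C by (intro mult_left_mono) auto
        also have "\<dots> = B * (2 * ln \<nu> + 4) / k" by (simp add: B_def)
        finally have s2: "sqrt (1152 * 504\<^sup>2 * 40128 * C * ((real J + 1) / real D)) \<le> sqrt (B * (2 * ln \<nu> + 4) / k)" by simp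
        have pos: "0 < 10 / real D / w1" using D10 w10 by simp
        have "10 / real D / w1 \<le> 1 / w1" using D1 w10 by (intro divide_right_mono) auto
        also have "\<dots> \<le> \<nu>" using w1inv pw by linarith
        finally have s3: "ln (10 / real D / w1) \<le> ln \<nu>"
          unfolding ln_le_cancel_iff[OF pos nu0] .
        have "G * sqrt (1152 * 504\<^sup>2 * 40128 * C * ((real J + 1) / real D)) * ln (10 / real D / w1)
          \<le> G * sqrt (1152 * 504\<^sup>2 * 40128 * C * ((real J + 1) / real D)) * ln \<nu>"
          using G0 C s3 by (intro mult_left_mono) auto
        also have "\<dots> \<le> G * sqrt (B * (2 * ln \<nu> + 4) / k) * ln \<nu>"
          using G0 nu1 s2 by (intro mult_right_mono mult_left_mono) auto
        finally show ?thesis unfolding s1 by (simp only: mult.assoc)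
      qed
      finally have "G / (640 * C) \<le> G * (24 * \<nu> powr (-1/3) + sqrt (B * (2 * ln \<nu> + 4) / k) * ln \<nu>)"
        by (simp add: distrib_left)
      also have "\<dots> < G * (1 / (640 * C))" using small G0 unfolding k_def by (intro mult_strict_left_mono)
      finally show False by simp
    qed
  qed
qed

section \<open>Reduction of the plane statement to coordinates\<close>

lemma homogeneous_points_swap:
  assumes "homogeneous_points P x y C h"
  shows "homogeneous_points P y x C h"
proof -
  interpret homogeneous_points P x y C h by (rule assms)
  show ?thesis
  proof
    show "real (card {p \<in> P. X \<le> y p \<and> y p \<le> X + h \<and> Y \<le> x p \<and> x p \<le> Y + h}) \<le> C" for X Y
    proof -
      have "{p \<in> P. X \<le> y p \<and> y p \<le> X + h \<and> Y \<le> x p \<and> x p \<le> Y + h} =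
          {p \<in> P. Y \<le> x p \<and> x p \<le> Y + h \<and> X \<le> y p \<and> y p \<le> X + h}" by blast
      then show ?thesis using homog[of Y X] by simp
    qed
  qed (use finite_P coords h_pos C_pos in auto)
qed

text \<open>Every ordered pair is flat or steep, so one of the two kinds accounts for at least half
  of all pairs; the steep case becomes the flat one when the axes are exchanged.\<close>

lemma card_cone_ge:
  fixes x y :: "'p \<Rightarrow> real"
  assumes P: "finite P"
  shows "(real (card P))\<^sup>2 / 2 \<le> real (card {(p, q). p \<in> P \<and> q \<in> P \<and> \<bar>y p - y q\<bar> \<le> \<bar>x p - x q\<bar>}) \<or>
    (real (card P))\<^sup>2 / 2 \<le> real (card {(p, q). p \<in> P \<and> q \<in> P \<and> \<bar>x p - x q\<bar> \<le> \<bar>y p - y q\<bar>})"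
proof -
  let ?A = "{(p, q). p \<in> P \<and> q \<in> P \<and> \<bar>y p - y q\<bar> \<le> \<bar>x p - x q\<bar>}"
  let ?B = "{(p, q). p \<in> P \<and> q \<in> P \<and> \<bar>x p - x q\<bar> \<le> \<bar>y p - y q\<bar>}"
  have "P \<times> P = ?A \<union> ?B" by auto
  then have "card P * card P \<le> card ?A + card ?B"
    using card_Un_le[of ?A ?B] by (metis card_cartesian_product)
  then have "real (card P) * real (card P) \<le> real (card ?A) + real (card ?B)"
    by (simp only: of_nat_mult[symmetric] of_nat_add[symmetric] of_nat_le_iff)
  then show ?thesis by (simp add: power2_eq_square) linarith
qed

lemma homogeneous_points_of_homogeneous:
  fixes P :: "(real^2) set"
  assumes "P \<subseteq> cbox 0 1" "finite P" "card P = n" "0 < n" "homogeneous C P"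
  shows "homogeneous_points P (\<lambda>p. p $ 1) (\<lambda>p. p $ 2) (max C 1) (1 / sqrt (real n))"
proof
  show "0 \<le> p $ 1 \<and> p $ 1 \<le> 1 \<and> 0 \<le> p $ 2 \<and> p $ 2 \<le> 1" if "p \<in> P" for p
    using assms(1) that by (auto simp: mem_box_cart dest!: subsetD)
  show "real (card {p \<in> P. X \<le> p $ 1 \<and> p $ 1 \<le> X + 1 / sqrt (real n) \<and> Y \<le> p $ 2 \<and> p $ 2 \<le> Y + 1 / sqrt (real n)}) \<le> max C 1" for X Y
  proof -
    define c :: "real^2" where "c = vector [X, Y]"
    have h: "real (card P) powr (-1/2) = 1 / sqrt (real n)"
      using assms(3,4) powr_minus_divide[of "real n" "1/2"] by (simp add: powr_half_sqrt)
    have "{p \<in> P. X \<le> p $ 1 \<and> p $ 1 \<le> X + 1 / sqrt (real n) \<and> Y \<le> p $ 2 \<and> p $ 2 \<le> Y + 1 / sqrt (real n)} =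
        P \<inter> axis_square c (real (card P) powr (-1/2))"
      unfolding h axis_square_def by (auto simp: mem_box_cart forall_2 c_def)
    then show ?thesis using assms(5) unfolding homogeneous_def by (metis max.coboundedI1)
  qed
qed (use assms in auto)

theorem theorem1p2:
  fixes C \<epsilon> :: real
  assumes "C > 0" and "\<epsilon> > 0"
  shows "\<exists>N::nat. \<forall>n\<ge>N. \<forall>P :: (real^2) set.
           P \<subseteq> cbox 0 1 \<and> finite P \<and> card P = n \<and> homogeneous C P \<longrightarrow>
           (\<exists>p\<in>P. \<exists>q\<in>P. \<exists>r\<in>P. p \<noteq> q \<and> p \<noteq> r \<and> q \<noteq> r \<and>
              measure lborel (convex hull {p, q, r}) \<le> real n powr (-7/6 + \<epsilon>))"
proof -
  \<comment> \<open>A smaller exponent loss gives a stronger bound, so \<open>\<epsilon>\<close> may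
    be capped at 1/3; likewise \<open>C\<close> may be raised to \<open>max C 1\<close>.\<close>
  define \<epsilon>' where "\<epsilon>' = min \<epsilon> (1 / 3)"
  have e: "0 < \<epsilon>'" "\<epsilon>' \<le> 1 / 3" "\<epsilon>' \<le> \<epsilon>" using assms by (auto simp: \<epsilon>'_def)
  obtain N :: nat where "\<forall>n\<ge>N. \<forall>(P :: (real^2) set) x y. homogeneous_points P x y (max C 1) (1 / sqrt (real n)) \<longrightarrow> card P = n \<longrightarrow>
    (real n)\<^sup>2 / 2 \<le> real (card {(p, q). p \<in> P \<and> q \<in> P \<and> \<bar>y p - y q\<bar> \<le> \<bar>x p - x q\<bar>}) \<longrightarrow>
    (\<exists>p\<in>P. \<exists>q\<in>P. \<exists>r\<in>P. p \<noteq> q \<and> p \<noteq> r \<and> q \<noteq> r \<and>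
       \<bar>(x q - x p) * (y r - y p) - (y q - y p) * (x r - x p)\<bar> \<le> 2 * real n powr (-7/6 + \<epsilon>'))"
    using homogeneous_points_small_det[OF max.cobounded2 e(1,2)] by (rule exE)
  note N = this[rule_format]
  show ?thesis
  \<comment> \<open>\<open>n \<ge> 1\<close> makes \<open>1 / sqrt n\<close> positive and powers of
    \<open>n\<close> monotone in the exponent.\<close>
  proof (intro exI[of _ "max N 1"] allI impI)
    fix n and P :: "(real^2) set"
    assume n: "max N 1 \<le> n" and P: "P \<subseteq> cbox 0 1 \<and> finite P \<and> card P = n \<and> homogeneous C P"
    then have hp: "homogeneous_points P (\<lambda>p. p $ 1) (\<lambda>p. p $ 2) (max C 1) (1 / sqrt (real n))"
      by (intro homogeneous_points_of_homogeneous) auto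
    have "\<exists>p\<in>P. \<exists>q\<in>P. \<exists>r\<in>P. p \<noteq> q \<and> p \<noteq> r \<and> q \<noteq> r \<and>
       \<bar>(q $ 1 - p $ 1) * (r $ 2 - p $ 2) - (q $ 2 - p $ 2) * (r $ 1 - p $ 1)\<bar> \<le> 2 * real n powr (-7/6 + \<epsilon>')"
      using card_cone_ge[of P "\<lambda>p. p $ 2" "\<lambda>p. p $ 1"]
    proof
      assume "(real (card P))\<^sup>2 / 2 \<le> real (card {(p, q). p \<in> P \<and> q \<in> P \<and> \<bar>p $ 2 - q $ 2\<bar> \<le> \<bar>p $ 1 - q $ 1\<bar>})"
      then show ?thesis using n P by (intro N[OF _ hp]) auto
    next
      assume "(real (card P))\<^sup>2 / 2 \<le> real (card {(p, q). p \<in> P \<and> q \<in> P \<and> \<bar>p $ 1 - q $ 1\<bar> \<le> \<bar>p $ 2 - q $ 2\<bar>})"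
      then have "\<exists>p\<in>P. \<exists>q\<in>P. \<exists>r\<in>P. p \<noteq> q \<and> p \<noteq> r \<and> q \<noteq> r \<and>
       \<bar>(q $ 2 - p $ 2) * (r $ 1 - p $ 1) - (q $ 1 - p $ 1) * (r $ 2 - p $ 2)\<bar> \<le> 2 * real n powr (-7/6 + \<epsilon>')"
        using n P by (intro N[OF _ homogeneous_points_swap[OF hp]]) auto
      then show ?thesis by (simp only: abs_minus_commute)
    qed (use P in auto)
    then obtain p q r where pqr: "p \<in> P" "q \<in> P" "r \<in> P" "p \<noteq> q" "p \<noteq> r" "q \<noteq> r"
      and det: "\<bar>(q $ 1 - p $ 1) * (r $ 2 - p $ 2) - (q $ 2 - p $ 2) * (r $ 1 - p $ 1)\<bar> \<le> 2 * real n powr (-7/6 + \<epsilon>')" by blast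
    have "measure lborel (convex hull {p, q, r}) = \<bar>(q $ 1 - p $ 1) * (r $ 2 - p $ 2) - (q $ 2 - p $ 2) * (r $ 1 - p $ 1)\<bar> / 2"
      unfolding content_triangle by (simp add: abs_minus_commute mult.commute)
    also have "\<dots> \<le> real n powr (-7/6 + \<epsilon>')" using det by simp
    also have "\<dots> \<le> real n powr (-7/6 + \<epsilon>)" using n e by (intro powr_mono) auto
    finally show "\<exists>p\<in>P. \<exists>q\<in>P. \<exists>r\<in>P. p \<noteq> q \<and> p \<noteq> r \<and> q \<noteq> r \<and>
              measure lborel (convex hull {p, q, r}) \<le> real n powr (-7/6 + \<epsilon>)" using pqr by blast
  qed
qed

end
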